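(* Let $R\subset S$ be an infra-integral FCP extension of commutative rings. Then $R\subset S$ has a co-subintegral closure $S^+_R$, and ${}_S^uR=S^+_R$, where ${}_S^uR$ is the u-closure of $R$ in $S$.
   Context: All rings are commutative and unital; $\subset$ denotes proper inclusion. $[R,S]$ is the set of all $R$-subalgebras of $S$, ordered by inclusion; $R\subseteq S$ has FCP if each chain in $[R,S]$ is finite. An integral extension $R\subseteq S$ is infra-integral if all its residual field extensions $\kappa_R(Q\cap R)\to\kappa_S(Q)$ ($Q\in\mathrm{Spec}(S)$) are isomorphisms, and subintegral if moreover $\mathrm{Spec}(S)\to\mathrm{Spec}(R)$ is injective. $R\subseteq S$ is u-closed (anodal) if $b\in S$ lies in $R$ whenever $b^2-b\in R$ and $b^3-b^2\in R$; the u-closure ${}_S^uR$ is the smallest $B\in[R,S]$ such that $B\subseteq S$ is u-closed. The co-subintegral closure $S^+_R$ of $R\subseteq S$, if it exists, is the least $V\in[R,S]$ such that $V\subseteq S$ is subintegral. *)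

theory Defs
  imports "HOL-Algebra.Polynomials"
begin

text \<open>
  A ring extension \<open>R \<subseteq> S\<close> is given by a ring record \<open>S\<close> and a set \<open>R\<close> with \<open>subcring R S\<close>;
  the ring structure on \<open>R\<close> is \<open>S\<lparr>carrier := R\<rparr>\<close>. The \<open>R\<close>-subalgebras of \<open>S\<close> are then the
  subrings of \<open>S\<close> containing \<open>R\<close>.
\<close>

definition ring_extension :: "'a set \<Rightarrow> ('a, 'm) ring_scheme \<Rightarrow> bool" where
  "ring_extension R S \<longleftrightarrow> cring S \<and> subcring R S"

definition subalgebras :: "'a set \<Rightarrow> ('a, 'm) ring_scheme \<Rightarrow> 'a set set" where
  "subalgebras R S = {T. subcring T S \<and> R \<subseteq> T}"

definition FCP :: "'a set \<Rightarrow> ('a, 'm) ring_scheme \<Rightarrow> bool" where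
  "FCP R S \<longleftrightarrow> (\<forall>C. subset.chain (subalgebras R S) C \<longrightarrow> finite C)"

text \<open>
  Coefficient lists of \<^const>\<open>ring.eval\<close> start with the leading coefficient, so
  \<open>\<one> # p\<close> ranges over the monic polynomials with coefficients in \<open>R\<close>.
\<close>

definition integral_extension :: "'a set \<Rightarrow> ('a, 'm) ring_scheme \<Rightarrow> bool" where
  "integral_extension R S \<longleftrightarrow> ring_extension R S \<and>
     (\<forall>x\<in>carrier S. \<exists>p. set p \<subseteq> R \<and> ring.eval S (\<one>\<^bsub>S\<^esub> # p) x = \<zero>\<^bsub>S\<^esub>)"

definition Spec :: "('a, 'm) ring_scheme \<Rightarrow> 'a set set" where
  "Spec A = {P. primeideal P A}"

text \<open>The pair \<open>(a, s)\<close> represents the fraction \<open>a / s\<close>.\<close>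

definition frac_rel :: "('a, 'm) ring_scheme \<Rightarrow> 'a set \<Rightarrow> (('a \<times> 'a) \<times> ('a \<times> 'a)) set" where
  "frac_rel A M = {((a, s), (b, t)). a \<in> carrier A \<and> s \<in> M \<and> b \<in> carrier A \<and> t \<in> M \<and>
     (\<exists>u\<in>M. u \<otimes>\<^bsub>A\<^esub> (a \<otimes>\<^bsub>A\<^esub> t) = u \<otimes>\<^bsub>A\<^esub> (b \<otimes>\<^bsub>A\<^esub> s))}"

definition fraction :: "('a, 'm) ring_scheme \<Rightarrow> 'a set \<Rightarrow> 'a \<Rightarrow> 'a \<Rightarrow> ('a \<times> 'a) set" where
  "fraction A M a s = frac_rel A M `` {(a, s)}"

definition localization :: "('a, 'm) ring_scheme \<Rightarrow> 'a set \<Rightarrow> ('a \<times> 'a) set ring" where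
  "localization A M =
    \<lparr>carrier = (carrier A \<times> M) // frac_rel A M,
     mult = (\<lambda>x y. \<Union>(a, s)\<in>x. \<Union>(b, t)\<in>y. fraction A M (a \<otimes>\<^bsub>A\<^esub> b) (s \<otimes>\<^bsub>A\<^esub> t)),
     one = fraction A M \<one>\<^bsub>A\<^esub> \<one>\<^bsub>A\<^esub>,
     zero = fraction A M \<zero>\<^bsub>A\<^esub> \<one>\<^bsub>A\<^esub>,
     add = (\<lambda>x y. \<Union>(a, s)\<in>x. \<Union>(b, t)\<in>y.
              fraction A M (a \<otimes>\<^bsub>A\<^esub> t \<oplus>\<^bsub>A\<^esub> b \<otimes>\<^bsub>A\<^esub> s) (s \<otimes>\<^bsub>A\<^esub> t))\<rparr>"

definition local_ring_at :: "('a, 'm) ring_scheme \<Rightarrow> 'a set \<Rightarrow> ('a \<times> 'a) set ring" where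
  "local_ring_at A P = localization A (carrier A - P)"

text \<open>The ideal \<open>P A\<^sub>P\<close> of \<open>A\<^sub>P\<close>.\<close>

definition local_max_ideal :: "('a, 'm) ring_scheme \<Rightarrow> 'a set \<Rightarrow> ('a \<times> 'a) set set" where
  "local_max_ideal A P = {fraction A (carrier A - P) a s | a s. a \<in> P \<and> s \<in> carrier A - P}"

definition residue_field :: "('a, 'm) ring_scheme \<Rightarrow> 'a set \<Rightarrow> ('a \<times> 'a) set set ring" where
  "residue_field A P = local_ring_at A P Quot local_max_ideal A P"

text \<open>
  The canonical map from the residue field of \<open>R\<close> at \<open>Q \<inter> R\<close> to that of \<open>S\<close> at \<open>Q\<close>. If \<open>x\<close> is
  the fraction \<open>a / s\<close> formed in \<open>R\<close>, i.e. a class of pairs, then the image of \<open>x\<close> under the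
  fraction relation of \<open>S\<close> is the fraction \<open>a / s\<close> formed in \<open>S\<close>.
\<close>

definition residue_map ::
    "('a, 'm) ring_scheme \<Rightarrow> 'a set \<Rightarrow> ('a \<times> 'a) set set \<Rightarrow> ('a \<times> 'a) set set" where
  "residue_map S Q c =
     (\<Union>x\<in>c. local_max_ideal S Q +>\<^bsub>local_ring_at S Q\<^esub> (frac_rel S (carrier S - Q) `` x))"

definition infra_integral :: "'a set \<Rightarrow> ('a, 'm) ring_scheme \<Rightarrow> bool" where
  "infra_integral R S \<longleftrightarrow> integral_extension R S \<and>
     (\<forall>Q\<in>Spec S. residue_map S Q \<in>
        ring_iso (residue_field (S\<lparr>carrier := R\<rparr>) (Q \<inter> R)) (residue_field S Q))"

definition subintegral :: "'a set \<Rightarrow> ('a, 'm) ring_scheme \<Rightarrow> bool" where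
  "subintegral R S \<longleftrightarrow> infra_integral R S \<and> inj_on (\<lambda>Q. Q \<inter> R) (Spec S)"

definition u_closed :: "'a set \<Rightarrow> ('a, 'm) ring_scheme \<Rightarrow> bool" where
  "u_closed R S \<longleftrightarrow> ring_extension R S \<and>
     (\<forall>b\<in>carrier S. b [^]\<^bsub>S\<^esub> (2::nat) \<ominus>\<^bsub>S\<^esub> b \<in> R \<and> b [^]\<^bsub>S\<^esub> (3::nat) \<ominus>\<^bsub>S\<^esub> b [^]\<^bsub>S\<^esub> (2::nat) \<in> R
        \<longrightarrow> b \<in> R)"

definition u_closure :: "'a set \<Rightarrow> ('a, 'm) ring_scheme \<Rightarrow> 'a set" where
  "u_closure R S = (LEAST B. B \<in> subalgebras R S \<and> u_closed B S)"

definition is_co_subintegral_closure :: "'a set \<Rightarrow> ('a, 'm) ring_scheme \<Rightarrow> 'a set \<Rightarrow> bool" where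
  "is_co_subintegral_closure R S V \<longleftrightarrow> V \<in> subalgebras R S \<and> subintegral V S \<and>
     (\<forall>W\<in>subalgebras R S. subintegral W S \<longrightarrow> V \<subseteq> W)"

definition co_subintegral_closure :: "'a set \<Rightarrow> ('a, 'm) ring_scheme \<Rightarrow> 'a set" where
  "co_subintegral_closure R S = (THE V. is_co_subintegral_closure R S V)"

text \<open>The least element in the definition of \<^const>\<open>u_closure\<close> always exists.\<close>

lemma u_closure_eq_Inter:
  assumes "ring_extension R S"
  shows "u_closure R S = \<Inter>{B \<in> subalgebras R S. u_closed B S}"
    and "u_closure R S \<in> subalgebras R S"
    and "u_closed (u_closure R S) S"
proof -
  interpret cring S
    using assms by (simp add: ring_extension_def)
  let ?F = "{B \<in> subalgebras R S. u_closed B S}"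
  have R: "R \<subseteq> carrier S"
    using assms by (simp add: ring_extension_def subcringE(1))
  then have top: "carrier S \<in> ?F"
    using cring_axioms carrier_is_subcring
    by (simp add: subalgebras_def u_closed_def ring_extension_def)
  have sub: "subcring (\<Inter>?F) S"
    using top by (intro subcring_Inter) (unfold subalgebras_def, blast+)
  have alg: "\<Inter>?F \<in> subalgebras R S"
    using sub unfolding subalgebras_def by blast
  have closed: "u_closed (\<Inter>?F) S"
    unfolding u_closed_def[of "\<Inter>?F"] ring_extension_def[of "\<Inter>?F"]
  proof (intro conjI ballI impI cring_axioms sub)
    fix b
    assume b: "b \<in> carrier S"
      and "b [^]\<^bsub>S\<^esub> (2::nat) \<ominus>\<^bsub>S\<^esub> b \<in> \<Inter>?F \<and> b [^]\<^bsub>S\<^esub> (3::nat) \<ominus>\<^bsub>S\<^esub> b [^]\<^bsub>S\<^esub> (2::nat) \<in> \<Inter>?F"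
    then show "b \<in> \<Inter>?F"
      unfolding u_closed_def by blast
  qed
  show eq: "u_closure R S = \<Inter>?F"
    unfolding u_closure_def by (rule Least_equality) (use alg closed in blast)+
  show "u_closure R S \<in> subalgebras R S" "u_closed (u_closure R S) S"
    unfolding eq by (fact alg, fact closed)
qed

end

theory Submission
  imports Defs
begin

text \<open>
  Let \<open>U\<close> be the u-closure of \<open>R\<close> in \<open>S\<close>. Two facts about an integral extension \<open>B \<subseteq> S\<close> suffice.

  If contraction \<open>Spec S \<rightarrow> Spec B\<close> is injective then \<open>B \<subseteq> S\<close> is u-closed: for \<open>b\<close> with
  \<open>b\<^sup>2 - b, b\<^sup>3 - b\<^sup>2 \<in> B\<close> the set \<open>{w \<in> B. w b \<in> B}\<close> is an ideal of \<open>B[b] = B + B b\<close>, and a prime \<open>M\<close> of \<open>B\<close>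
  containing it lies below the two primes \<open>M + B b\<close> and \<open>M + B (1 - b)\<close> of \<open>B[b]\<close>, which extend to
  different primes of \<open>S\<close>. Hence \<open>U\<close> lies in every \<open>W\<close> with \<open>W \<subseteq> S\<close> subintegral.

  Conversely, let \<open>B \<subseteq> S\<close> be u-closed with FCP, and let \<open>Q \<noteq> Q'\<close> be primes of \<open>S\<close> above the same \<open>P\<close>.
  Nakayama's lemma and the chain condition show that \<open>P\<close> is maximal and that \<open>u P\<^sup>r S \<subseteq> B\<close> for some
  \<open>u \<in> 1 + P\<close>. An integral equation of an element of \<open>Q - Q'\<close> yields, modulo \<open>P S\<close>, an idempotent that
  separates \<open>Q\<close> from \<open>Q'\<close>; its product with \<open>u\<close> lifts to some \<open>b\<close> with \<open>b\<^sup>2 - b \<in> u P\<^sup>r S\<close>, so that \<open>b \<in> B\<close>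
  by u-closedness, a contradiction. Hence \<open>Spec S \<rightarrow> Spec U\<close> is injective. The residual isomorphisms
  pass from \<open>R\<close> to \<open>U\<close> because they say that every \<open>y \<in> S\<close> is a fraction of elements of \<open>R\<close> modulo \<open>Q\<close>.
\<close>

section \<open>Residue fields\<close>

context ideal
begin

lemma zero_mem: "\<zero> \<in> I"
  by (rule additive_subgroup.zero_closed[OF additive_subgroup_axioms])

lemma add_mem: "a \<in> I \<Longrightarrow> b \<in> I \<Longrightarrow> a \<oplus> b \<in> I"
  by (rule additive_subgroup.a_closed[OF additive_subgroup_axioms])

end

context primeideal
begin

abbreviation compl where "compl \<equiv> carrier R - I"
abbreviation frac where "frac \<equiv> fraction R compl"

lemma one_notin: "\<one> \<notin> I"
  using I_notcarr one_imp_carrier by blast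

lemma one_compl: "\<one> \<in> compl"
  using one_notin by simp

lemma mult_compl: "s \<in> compl \<Longrightarrow> t \<in> compl \<Longrightarrow> s \<otimes> t \<in> compl"
  using I_prime by blast

lemma mem_of_mult_mem: "s \<in> compl \<Longrightarrow> a \<in> carrier R \<Longrightarrow> s \<otimes> a \<in> I \<Longrightarrow> a \<in> I"
  using I_prime by blast

section \<open>Congruences modulo a prime ideal\<close>

lemma cong_mult:
  assumes "x \<ominus> y \<in> I" "k \<in> carrier R" "x \<in> carrier R" "y \<in> carrier R"
  shows "k \<otimes> x \<ominus> k \<otimes> y \<in> I"
proof -
  have "k \<otimes> x \<ominus> k \<otimes> y = k \<otimes> (x \<ominus> y)"
    using assms(2-4) by algebra
  then show ?thesis
    using assms(1,2) by (simp add: I_l_closed)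
qed

lemma cong_cancel:
  assumes "k \<otimes> x \<ominus> k \<otimes> y \<in> I" "k \<in> compl" "x \<in> carrier R" "y \<in> carrier R"
  shows "x \<ominus> y \<in> I"
proof -
  have "k \<otimes> (x \<ominus> y) = k \<otimes> x \<ominus> k \<otimes> y"
    using assms(2-4) by (simp add: r_minus r_distr a_minus_def)
  then show ?thesis
    using assms mem_of_mult_mem[of k "x \<ominus> y"] by simp
qed

lemma cong_add:
  assumes "x \<ominus> y \<in> I" "x' \<ominus> y' \<in> I"
    "x \<in> carrier R" "y \<in> carrier R" "x' \<in> carrier R" "y' \<in> carrier R"
  shows "(x \<oplus> x') \<ominus> (y \<oplus> y') \<in> I"
proof -
  have "(x \<oplus> x') \<ominus> (y \<oplus> y') = (x \<ominus> y) \<oplus> (x' \<ominus> y')"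
    using assms(3-6) by algebra
  then show ?thesis
    using add_mem[OF assms(1,2)] by simp
qed

lemma cong_trans:
  assumes "x \<ominus> y \<in> I" "y \<ominus> z \<in> I" "x \<in> carrier R" "y \<in> carrier R" "z \<in> carrier R"
  shows "x \<ominus> z \<in> I"
proof -
  have "x \<ominus> z = (x \<ominus> y) \<oplus> (y \<ominus> z)"
    using assms(3-5) by algebra
  then show ?thesis
    using add_mem[OF assms(1,2)] by simp
qed

lemma cong_sym:
  assumes "x \<ominus> y \<in> I" "x \<in> carrier R" "y \<in> carrier R"
  shows "y \<ominus> x \<in> I"
proof -
  have "y \<ominus> x = \<ominus> (x \<ominus> y)"
    using assms(2,3) by algebra
  then show ?thesis
    using assms(1) by simp
qed

lemma cong_mult2:
  assumes "x \<ominus> y \<in> I" "x' \<ominus> y' \<in> I"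
    "x \<in> carrier R" "y \<in> carrier R" "x' \<in> carrier R" "y' \<in> carrier R"
  shows "x \<otimes> x' \<ominus> y \<otimes> y' \<in> I"
  using assms cong_mult[of x y x'] cong_mult[of x' y' y] cong_trans[of "x' \<otimes> x" "x' \<otimes> y" "y \<otimes> y'"]
    m_comm[of x x'] m_comm[of x' y] by auto

lemma mem_if_pow_mem:
  assumes "x \<in> carrier R" "x [^] (n::nat) \<in> I"
  shows "x \<in> I"
  using assms(2)
proof (induction n)
  case 0
  then show ?case using one_notin by simp
next
  case (Suc n)
  then show ?case using I_prime[of "x [^] n" x] assms(1) by auto
qed

section \<open>Fractions at a prime, computed on representatives\<close>

lemma equiv_frac_rel: "equiv (carrier R \<times> compl) (frac_rel R compl)"
proof (rule equivI)
  show "frac_rel R compl \<subseteq> (carrier R \<times> compl) \<times> (carrier R \<times> compl)"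
    by (auto simp: frac_rel_def)
  show "refl_on (carrier R \<times> compl) (frac_rel R compl)"
    using one_compl by (auto simp: frac_rel_def refl_on_def)
  show "sym (frac_rel R compl)"
    by (rule symI) (auto simp: frac_rel_def intro: sym)
  show "trans (frac_rel R compl)"
  proof (rule transI, clarify)
    fix a s b t c w
    assume "((a, s), (b, t)) \<in> frac_rel R compl" "((b, t), (c, w)) \<in> frac_rel R compl"
    then obtain u v where mem: "a \<in> carrier R" "b \<in> carrier R" "c \<in> carrier R"
        "s \<in> compl" "t \<in> compl" "w \<in> compl" "u \<in> compl" "v \<in> compl"
      and u: "u \<otimes> (a \<otimes> t) = u \<otimes> (b \<otimes> s)" and v: "v \<otimes> (b \<otimes> w) = v \<otimes> (c \<otimes> t)"
      by (auto simp: frac_rel_def)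
    have car: "s \<in> carrier R" "t \<in> carrier R" "w \<in> carrier R" "u \<in> carrier R" "v \<in> carrier R"
      using mem by auto
    \<comment> \<open>The middle denominator t joins the two witnesses u and v as a factor; u v t
      stays outside the prime by \<open>mult_compl\<close>.\<close>
    have "(u \<otimes> v \<otimes> t) \<otimes> (a \<otimes> w) = (u \<otimes> (a \<otimes> t)) \<otimes> (v \<otimes> w)"
      using mem(1-3) car by (simp add: m_ac)
    also have "\<dots> = (v \<otimes> (b \<otimes> w)) \<otimes> (u \<otimes> s)"
      unfolding u using mem(1-3) car by (simp add: m_ac)
    also have "\<dots> = (u \<otimes> v \<otimes> t) \<otimes> (c \<otimes> s)"
      unfolding v using mem(1-3) car by (simp add: m_ac)
    finally show "((a, s), (c, w)) \<in> frac_rel R compl"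
      using mem mult_compl unfolding frac_rel_def by blast
  qed
qed

lemma frac_eq_iff:
  assumes "a \<in> carrier R" "b \<in> carrier R" "s \<in> compl" "t \<in> compl"
  shows "frac a s = frac b t \<longleftrightarrow> (\<exists>u\<in>compl. u \<otimes> (a \<otimes> t) = u \<otimes> (b \<otimes> s))"
proof -
  have "frac a s = frac b t \<longleftrightarrow> ((a, s), (b, t)) \<in> frac_rel R compl"
    unfolding fraction_def using assms by (intro eq_equiv_class_iff[OF equiv_frac_rel]) auto
  then show ?thesis
    using assms by (auto simp: frac_rel_def)
qed

lemma frac_eqI:
  assumes "a \<in> carrier R" "b \<in> carrier R" "s \<in> compl" "t \<in> compl" "a \<otimes> t = b \<otimes> s"
  shows "frac a s = frac b t"
  using assms one_compl frac_eq_iff by auto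

lemma mem_frac:
  assumes "a \<in> carrier R" "s \<in> compl"
  shows "(b, t) \<in> frac a s \<longleftrightarrow> b \<in> carrier R \<and> t \<in> compl \<and> frac b t = frac a s"
proof -
  have "(b, t) \<in> frac a s \<longleftrightarrow> b \<in> carrier R \<and> t \<in> compl \<and> ((a, s), (b, t)) \<in> frac_rel R compl"
    by (auto simp: fraction_def frac_rel_def)
  also have "\<dots> \<longleftrightarrow> b \<in> carrier R \<and> t \<in> compl \<and> frac a s = frac b t"
    using assms frac_eq_iff[of a b s t] by (auto simp: frac_rel_def)
  finally show ?thesis
    by metis
qed

lemma self_mem_frac: "a \<in> carrier R \<Longrightarrow> s \<in> compl \<Longrightarrow> (a, s) \<in> frac a s"
  by (simp add: mem_frac)

lemma carrier_local_ring:
  "carrier (local_ring_at R I) = {frac a s | a s. a \<in> carrier R \<and> s \<in> compl}"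
  by (auto simp: local_ring_at_def localization_def quotient_def fraction_def)

text \<open>The operations of \<open>localization\<close> are unions over all pairs of
  representatives. If every pair yields the same set Y, the union collapses to Y, because the
  classes are nonempty.\<close>

lemma UN_frac_cong:
  assumes "a \<in> carrier R" "b \<in> carrier R" "s \<in> compl" "t \<in> compl"
    and "\<And>a' s' b' t'. \<lbrakk>a' \<in> carrier R; s' \<in> compl; frac a' s' = frac a s;
           b' \<in> carrier R; t' \<in> compl; frac b' t' = frac b t\<rbrakk> \<Longrightarrow> F a' s' b' t' = Y"
  shows "(\<Union>(a', s')\<in>frac a s. \<Union>(b', t')\<in>frac b t. F a' s' b' t') = Y"
proof -
  have "F a' s' b' t' = Y" if "(a', s') \<in> frac a s" "(b', t') \<in> frac b t" for a' s' b' t'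
    using that assms by (auto simp: mem_frac)
  moreover have "(a, s) \<in> frac a s" "(b, t) \<in> frac b t"
    using assms(1-4) by (simp_all add: self_mem_frac)
  ultimately show ?thesis
    by (auto 0 3)
qed

lemma mult_frac:
  assumes "a \<in> carrier R" "b \<in> carrier R" "s \<in> compl" "t \<in> compl"
  shows "frac a s \<otimes>\<^bsub>local_ring_at R I\<^esub> frac b t = frac (a \<otimes> b) (s \<otimes> t)"
  unfolding local_ring_at_def localization_def monoid.simps ring.simps
proof (rule UN_frac_cong[OF assms])
  fix a' s' b' t'
  assume *: "a' \<in> carrier R" "s' \<in> compl" "frac a' s' = frac a s"
    "b' \<in> carrier R" "t' \<in> compl" "frac b' t' = frac b t"
  then obtain u v where uv: "u \<in> compl" "v \<in> compl"
    and u: "u \<otimes> (a' \<otimes> s) = u \<otimes> (a \<otimes> s')" and v: "v \<otimes> (b' \<otimes> t) = v \<otimes> (b \<otimes> t')"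
    using assms by (auto simp: frac_eq_iff)
  have car: "s \<in> carrier R" "t \<in> carrier R" "s' \<in> carrier R" "t' \<in> carrier R" "u \<in> carrier R" "v \<in> carrier R"
    using * uv assms by auto
  have "(u \<otimes> v) \<otimes> ((a' \<otimes> b') \<otimes> (s \<otimes> t)) = (u \<otimes> (a' \<otimes> s)) \<otimes> (v \<otimes> (b' \<otimes> t))"
    using * assms car by (simp add: m_ac)
  also have "\<dots> = (u \<otimes> v) \<otimes> ((a \<otimes> b) \<otimes> (s' \<otimes> t'))"
    unfolding u v using * assms car by (simp add: m_ac)
  finally show "frac (a' \<otimes> b') (s' \<otimes> t') = frac (a \<otimes> b) (s \<otimes> t)"
    using * assms mult_compl uv by (subst frac_eq_iff) auto
qed

lemma add_frac:
  assumes "a \<in> carrier R" "b \<in> carrier R" "s \<in> compl" "t \<in> compl"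
  shows "frac a s \<oplus>\<^bsub>local_ring_at R I\<^esub> frac b t = frac (a \<otimes> t \<oplus> b \<otimes> s) (s \<otimes> t)"
  unfolding local_ring_at_def localization_def monoid.simps ring.simps
proof (rule UN_frac_cong[OF assms])
  fix a' s' b' t'
  assume *: "a' \<in> carrier R" "s' \<in> compl" "frac a' s' = frac a s"
    "b' \<in> carrier R" "t' \<in> compl" "frac b' t' = frac b t"
  then obtain u v where uv: "u \<in> compl" "v \<in> compl"
    and u: "u \<otimes> (a' \<otimes> s) = u \<otimes> (a \<otimes> s')" and v: "v \<otimes> (b' \<otimes> t) = v \<otimes> (b \<otimes> t')"
    using assms by (auto simp: frac_eq_iff)
  have car: "s \<in> carrier R" "t \<in> carrier R" "s' \<in> carrier R" "t' \<in> carrier R" "u \<in> carrier R" "v \<in> carrier R"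
    using * uv assms by auto
  have "(u \<otimes> v) \<otimes> ((a' \<otimes> t' \<oplus> b' \<otimes> s') \<otimes> (s \<otimes> t))
      = (u \<otimes> (a' \<otimes> s)) \<otimes> (v \<otimes> (t \<otimes> t')) \<oplus> (v \<otimes> (b' \<otimes> t)) \<otimes> (u \<otimes> (s \<otimes> s'))"
    using * assms car by (simp add: m_ac r_distr l_distr)
  also have "\<dots> = (u \<otimes> v) \<otimes> ((a \<otimes> t \<oplus> b \<otimes> s) \<otimes> (s' \<otimes> t'))"
    unfolding u v using * assms car by (simp add: m_ac r_distr l_distr)
  finally show "frac (a' \<otimes> t' \<oplus> b' \<otimes> s') (s' \<otimes> t') = frac (a \<otimes> t \<oplus> b \<otimes> s) (s \<otimes> t)"
    using * assms mult_compl uv car by (subst frac_eq_iff) auto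
qed

text \<open>This is the coset of the fraction a/s in the residue field, described without cosets:
  b/t lies in it when b s and a t agree modulo the prime. It reduces computation in the residue
  field to congruences in the ring.\<close>

definition residue_class where
  "residue_class a s = {frac b t | b t. b \<in> carrier R \<and> t \<in> compl \<and> b \<otimes> s \<ominus> a \<otimes> t \<in> I}"

lemma coset_frac:
  assumes a: "a \<in> carrier R" and s: "s \<in> compl"
  shows "local_max_ideal R I +>\<^bsub>local_ring_at R I\<^esub> frac a s = residue_class a s"
proof -
  have "frac q t \<oplus>\<^bsub>local_ring_at R I\<^esub> frac a s \<in> residue_class a s" if "q \<in> I" "t \<in> compl" for q t
  proof -
    have car: "s \<in> carrier R" "t \<in> carrier R" "q \<in> carrier R"
      using s that by auto
    have "(q \<otimes> s \<oplus> a \<otimes> t) \<otimes> s \<ominus> a \<otimes> (t \<otimes> s) = s \<otimes> s \<otimes> q"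
      using a car by algebra
    also have "\<dots> \<in> I"
      using that car by (intro I_l_closed) auto
    finally show ?thesis
      unfolding residue_class_def add_frac[OF car(3) a that(2) s]
      using a s car mult_compl[OF that(2) s] by blast
  qed
  moreover have "x \<in> local_max_ideal R I +>\<^bsub>local_ring_at R I\<^esub> frac a s" if x: "x \<in> residue_class a s" for x
  proof -
    obtain b v where xb: "x = frac b v" and b: "b \<in> carrier R" "v \<in> compl" "b \<otimes> s \<ominus> a \<otimes> v \<in> I"
      using x unfolding residue_class_def by blast
    have car: "s \<in> carrier R" "v \<in> carrier R"
      using s b by auto
    \<comment> \<open>The difference b/v - a/s, written over the denominator v s, has its numerator
      in the prime ideal, so it is the required element of \<open>local_max_ideal\<close>.\<close>
    have "frac (b \<otimes> s \<ominus> a \<otimes> v) (v \<otimes> s) \<oplus>\<^bsub>local_ring_at R I\<^esub> frac a s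
        = frac ((b \<otimes> s \<ominus> a \<otimes> v) \<otimes> s \<oplus> a \<otimes> (v \<otimes> s)) (v \<otimes> s \<otimes> s)"
      using a b s car by (intro add_frac mult_compl) auto
    also have "\<dots> = frac b v"
    proof (intro frac_eqI mult_compl)
      show "((b \<otimes> s \<ominus> a \<otimes> v) \<otimes> s \<oplus> a \<otimes> (v \<otimes> s)) \<otimes> v = b \<otimes> (v \<otimes> s \<otimes> s)"
        using a b(1) car by algebra
    qed (use a b s car in auto)
    finally have "x = frac (b \<otimes> s \<ominus> a \<otimes> v) (v \<otimes> s) \<oplus>\<^bsub>local_ring_at R I\<^esub> frac a s"
      using xb by simp
    moreover have "frac (b \<otimes> s \<ominus> a \<otimes> v) (v \<otimes> s) \<in> local_max_ideal R I"
      unfolding local_max_ideal_def using b mult_compl[OF b(2) s] by blast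
    ultimately show ?thesis
      unfolding a_r_coset_def' by blast
  qed
  ultimately show ?thesis
    unfolding a_r_coset_def' local_max_ideal_def by (intro equalityI subsetI) auto
qed

text \<open>Membership in \<open>residue_class\<close> allows any representative of the fraction, so
  independence of the representative has to be shown. Two representatives agree only up to a factor
  u outside the prime; multiplying by u t' and cancelling that product modulo the prime gives the
  congruence.\<close>

lemma frac_mem_residue_class:
  assumes "a \<in> carrier R" "b \<in> carrier R" "s \<in> compl" "t \<in> compl"
  shows "frac b t \<in> residue_class a s \<longleftrightarrow> b \<otimes> s \<ominus> a \<otimes> t \<in> I"
proof
  have car: "s \<in> carrier R" "t \<in> carrier R"
    using assms by auto
  assume "frac b t \<in> residue_class a s"
  then obtain b' t' where b': "b' \<in> carrier R" "t' \<in> compl" "b' \<otimes> s \<ominus> a \<otimes> t' \<in> I"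
    and eq: "frac b t = frac b' t'"
    unfolding residue_class_def by blast
  obtain u where u: "u \<in> compl" "u \<otimes> (b \<otimes> t') = u \<otimes> (b' \<otimes> t)"
    using eq assms b' by (auto simp: frac_eq_iff)
  have car': "t' \<in> carrier R" "u \<in> carrier R"
    using b' u by auto
  have "(u \<otimes> t') \<otimes> (b \<otimes> s \<ominus> a \<otimes> t) = (u \<otimes> (b \<otimes> t')) \<otimes> s \<ominus> u \<otimes> t' \<otimes> a \<otimes> t"
    using assms(1,2) car car' by algebra
  also have "\<dots> = u \<otimes> t \<otimes> (b' \<otimes> s \<ominus> a \<otimes> t')"
    unfolding u(2) using assms(1,2) b'(1) car car' by algebra
  also have "\<dots> \<in> I"
    using b' car car' by (intro I_l_closed) auto
  finally show "b \<otimes> s \<ominus> a \<otimes> t \<in> I"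
    using mem_of_mult_mem[OF mult_compl[OF u(1) b'(2)]] assms car by auto
next
  assume "b \<otimes> s \<ominus> a \<otimes> t \<in> I"
  then show "frac b t \<in> residue_class a s"
    unfolding residue_class_def using assms by blast
qed

lemma residue_class_eq_iff:
  assumes "a \<in> carrier R" "b \<in> carrier R" "s \<in> compl" "t \<in> compl"
  shows "residue_class b t = residue_class a s \<longleftrightarrow> b \<otimes> s \<ominus> a \<otimes> t \<in> I"
proof
  have car: "s \<in> carrier R" "t \<in> carrier R"
    using assms by auto
  show "b \<otimes> s \<ominus> a \<otimes> t \<in> I" if "residue_class b t = residue_class a s"
  proof -
    have "b \<otimes> t \<ominus> b \<otimes> t \<in> I"
      using assms car by (simp add: a_minus_def r_neg)
    then have "frac b t \<in> residue_class b t"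
      using assms by (simp add: frac_mem_residue_class)
    then show ?thesis
      using that assms by (simp add: frac_mem_residue_class)
  qed
  \<comment> \<open>Stated for fresh a, b, s, t because the two inclusions use it with the fractions
    exchanged. The common denominator t is cancelled at the end, being outside the prime.\<close>
  have sub: "residue_class b t \<subseteq> residue_class a s"
    if "a \<in> carrier R" "b \<in> carrier R" "s \<in> compl" "t \<in> compl" "b \<otimes> s \<ominus> a \<otimes> t \<in> I" for a b s t
  proof
    fix x assume "x \<in> residue_class b t"
    then obtain c v where c: "c \<in> carrier R" "v \<in> compl" "c \<otimes> t \<ominus> b \<otimes> v \<in> I" "x = frac c v"
      unfolding residue_class_def by blast
    have car: "s \<in> carrier R" "t \<in> carrier R" "v \<in> carrier R"
      using that c by auto
    have "s \<otimes> (c \<otimes> t) \<ominus> s \<otimes> (b \<otimes> v) \<in> I" "v \<otimes> (b \<otimes> s) \<ominus> v \<otimes> (a \<otimes> t) \<in> I"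
      using that c car by (simp_all add: cong_mult)
    moreover have "v \<otimes> (b \<otimes> s) = s \<otimes> (b \<otimes> v)" "s \<otimes> (c \<otimes> t) = t \<otimes> (c \<otimes> s)"
        "v \<otimes> (a \<otimes> t) = t \<otimes> (a \<otimes> v)"
      using that(1,2) c(1) car by (simp_all add: m_ac)
    ultimately have "t \<otimes> (c \<otimes> s) \<ominus> t \<otimes> (a \<otimes> v) \<in> I"
      using that(1,2) c(1) car cong_trans[of "s \<otimes> (c \<otimes> t)" "s \<otimes> (b \<otimes> v)" "v \<otimes> (a \<otimes> t)"] by simp
    then have "c \<otimes> s \<ominus> a \<otimes> v \<in> I"
      using that c car by (auto intro!: cong_cancel[of t "c \<otimes> s" "a \<otimes> v"])
    then show "x \<in> residue_class a s"
      unfolding residue_class_def using c by blast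
  qed
  show "residue_class b t = residue_class a s" if *: "b \<otimes> s \<ominus> a \<otimes> t \<in> I"
  proof (rule antisym)
    have "a \<otimes> t \<ominus> b \<otimes> s \<in> I"
      using cong_sym[OF *] assms(1,2) car by simp
    then show "residue_class a s \<subseteq> residue_class b t"
      by (intro sub assms)
  qed (intro sub assms *)
qed

lemma carrier_residue_field:
  "carrier (residue_field R I) = {residue_class a s | a s. a \<in> carrier R \<and> s \<in> compl}"
proof -
  have "carrier (residue_field R I) = (\<lambda>x. local_max_ideal R I +>\<^bsub>local_ring_at R I\<^esub> x) `
      (\<lambda>(a, s). frac a s) ` (carrier R \<times> compl)"
    unfolding residue_field_def FactRing_def partial_object.simps A_RCOSETS_def' carrier_local_ring
    by auto
  also have "\<dots> = (\<lambda>(a, s). residue_class a s) ` (carrier R \<times> compl)"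
    unfolding image_image by (rule image_cong) (auto simp: coset_frac)
  finally show ?thesis
    by auto
qed

lemma residue_class_cases:
  assumes "x \<in> residue_class a s"
  obtains b t where "x = frac b t" "b \<in> carrier R" "t \<in> compl" "b \<otimes> s \<ominus> a \<otimes> t \<in> I"
  using assms unfolding residue_class_def by blast

lemma frac_self_mem: "a \<in> carrier R \<Longrightarrow> s \<in> compl \<Longrightarrow> frac a s \<in> residue_class a s"
  using residue_class_eq_iff[of a a s s] by (simp add: frac_mem_residue_class)

text \<open>The product in \<open>FactRing\<close> is a union of cosets over all pairs of
  representatives, so each such pair must be shown to give the same coset.\<close>

lemma mult_residue_class:
  assumes "a \<in> carrier R" "b \<in> carrier R" "s \<in> compl" "t \<in> compl"
  shows "residue_class a s \<otimes>\<^bsub>residue_field R I\<^esub> residue_class b t = residue_class (a \<otimes> b) (s \<otimes> t)"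
proof -
  have car: "s \<in> carrier R" "t \<in> carrier R"
    using assms by auto
  have "local_max_ideal R I +>\<^bsub>local_ring_at R I\<^esub> (x \<otimes>\<^bsub>local_ring_at R I\<^esub> y)
      = residue_class (a \<otimes> b) (s \<otimes> t)"
    if xy: "x \<in> residue_class a s" "y \<in> residue_class b t" for x y
  proof -
    obtain a' s' where x: "x = frac a' s'" "a' \<in> carrier R" "s' \<in> compl" "a' \<otimes> s \<ominus> a \<otimes> s' \<in> I"
      using xy(1) by (rule residue_class_cases)
    obtain b' t' where y: "y = frac b' t'" "b' \<in> carrier R" "t' \<in> compl" "b' \<otimes> t \<ominus> b \<otimes> t' \<in> I"
      using xy(2) by (rule residue_class_cases)
    have car': "s' \<in> carrier R" "t' \<in> carrier R"
      using x y by auto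
    have "(b' \<otimes> t) \<otimes> (a' \<otimes> s) \<ominus> (b' \<otimes> t) \<otimes> (a \<otimes> s') \<in> I"
        "(a \<otimes> s') \<otimes> (b' \<otimes> t) \<ominus> (a \<otimes> s') \<otimes> (b \<otimes> t') \<in> I"
      using assms(1,2) x y car car' by (simp_all add: cong_mult)
    moreover have "(b' \<otimes> t) \<otimes> (a' \<otimes> s) = a' \<otimes> b' \<otimes> (s \<otimes> t)"
        "(a \<otimes> s') \<otimes> (b' \<otimes> t) = (b' \<otimes> t) \<otimes> (a \<otimes> s')"
        "(a \<otimes> s') \<otimes> (b \<otimes> t') = a \<otimes> b \<otimes> (s' \<otimes> t')"
      using assms(1,2) x(2) y(2) car car' by (simp_all add: m_ac)
    ultimately have "a' \<otimes> b' \<otimes> (s \<otimes> t) \<ominus> a \<otimes> b \<otimes> (s' \<otimes> t') \<in> I"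
      using assms(1,2) x(2) y(2) car car'
        cong_trans[of "(b' \<otimes> t) \<otimes> (a' \<otimes> s)" "(b' \<otimes> t) \<otimes> (a \<otimes> s')" "(a \<otimes> s') \<otimes> (b \<otimes> t')"]
      by simp
    then have "residue_class (a' \<otimes> b') (s' \<otimes> t') = residue_class (a \<otimes> b) (s \<otimes> t)"
      using assms x(2,3) y(2,3) mult_compl[OF assms(3,4)] mult_compl[OF x(3) y(3)]
      by (subst residue_class_eq_iff) auto
    moreover have "x \<otimes>\<^bsub>local_ring_at R I\<^esub> y = frac (a' \<otimes> b') (s' \<otimes> t')"
      unfolding x(1) y(1) by (intro mult_frac x y)
    ultimately show ?thesis
      using coset_frac[of "a' \<otimes> b'" "s' \<otimes> t'"] x(2) y(2) mult_compl[OF x(3) y(3)] by simp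
  qed
  then show ?thesis
    unfolding residue_field_def FactRing_def monoid.simps rcoset_mult_def
    using frac_self_mem assms by blast
qed

text \<open>The sum in \<open>FactRing\<close> is the setwise sum, so equality has two directions:
  congruences show that sums land in the class, and every member of the class must be split as a
  sum.\<close>

lemma add_residue_class:
  assumes "a \<in> carrier R" "b \<in> carrier R" "s \<in> compl" "t \<in> compl"
  shows "residue_class a s \<oplus>\<^bsub>residue_field R I\<^esub> residue_class b t
    = residue_class (a \<otimes> t \<oplus> b \<otimes> s) (s \<otimes> t)"
proof -
  have car: "s \<in> carrier R" "t \<in> carrier R"
    using assms by auto
  have "x \<oplus>\<^bsub>local_ring_at R I\<^esub> y \<in> residue_class (a \<otimes> t \<oplus> b \<otimes> s) (s \<otimes> t)"
    if xy: "x \<in> residue_class a s" "y \<in> residue_class b t" for x y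
  proof -
    obtain a' s' where x: "x = frac a' s'" "a' \<in> carrier R" "s' \<in> compl" "a' \<otimes> s \<ominus> a \<otimes> s' \<in> I"
      using xy(1) by (rule residue_class_cases)
    obtain b' t' where y: "y = frac b' t'" "b' \<in> carrier R" "t' \<in> compl" "b' \<otimes> t \<ominus> b \<otimes> t' \<in> I"
      using xy(2) by (rule residue_class_cases)
    have car': "s' \<in> carrier R" "t' \<in> carrier R"
      using x y by auto
    have "((t \<otimes> t') \<otimes> (a' \<otimes> s) \<oplus> (s \<otimes> s') \<otimes> (b' \<otimes> t))
        \<ominus> ((t \<otimes> t') \<otimes> (a \<otimes> s') \<oplus> (s \<otimes> s') \<otimes> (b \<otimes> t')) \<in> I"
      using assms(1,2) x y car car' by (intro cong_add cong_mult) auto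
    moreover have "(t \<otimes> t') \<otimes> (a' \<otimes> s) \<oplus> (s \<otimes> s') \<otimes> (b' \<otimes> t) = (a' \<otimes> t' \<oplus> b' \<otimes> s') \<otimes> (s \<otimes> t)"
        "(t \<otimes> t') \<otimes> (a \<otimes> s') \<oplus> (s \<otimes> s') \<otimes> (b \<otimes> t') = (a \<otimes> t \<oplus> b \<otimes> s) \<otimes> (s' \<otimes> t')"
      using assms(1,2) x(2) y(2) car car' by (simp_all add: m_ac l_distr r_distr)
    ultimately have "frac (a' \<otimes> t' \<oplus> b' \<otimes> s') (s' \<otimes> t') \<in> residue_class (a \<otimes> t \<oplus> b \<otimes> s) (s \<otimes> t)"
      using x y assms car car' mult_compl by (subst frac_mem_residue_class) auto
    then show ?thesis
      unfolding x(1) y(1) using x y by (simp add: add_frac)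
  qed
  then have "residue_class a s <+>\<^bsub>local_ring_at R I\<^esub> residue_class b t
      \<subseteq> residue_class (a \<otimes> t \<oplus> b \<otimes> s) (s \<otimes> t)"
    unfolding set_add_def' by auto
  moreover have "x \<in> residue_class a s <+>\<^bsub>local_ring_at R I\<^esub> residue_class b t"
    if mem: "x \<in> residue_class (a \<otimes> t \<oplus> b \<otimes> s) (s \<otimes> t)" for x
  proof -
    obtain c v where x: "x = frac c v" "c \<in> carrier R" "v \<in> compl"
      "c \<otimes> (s \<otimes> t) \<ominus> (a \<otimes> t \<oplus> b \<otimes> s) \<otimes> v \<in> I"
      using mem by (rule residue_class_cases)
    have v: "v \<in> carrier R"
      using x by auto
    \<comment> \<open>For the splitting the first summand is fixed as a/s; the second is then the
      difference c/v - a/s over the denominator s v.\<close>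
    have "frac a s \<oplus>\<^bsub>local_ring_at R I\<^esub> frac (c \<otimes> s \<ominus> a \<otimes> v) (s \<otimes> v)
        = frac (a \<otimes> (s \<otimes> v) \<oplus> (c \<otimes> s \<ominus> a \<otimes> v) \<otimes> s) (s \<otimes> (s \<otimes> v))"
      using assms x car v by (intro add_frac mult_compl) auto
    also have "\<dots> = frac c v"
    proof (intro frac_eqI mult_compl)
      show "(a \<otimes> (s \<otimes> v) \<oplus> (c \<otimes> s \<ominus> a \<otimes> v) \<otimes> s) \<otimes> v = c \<otimes> (s \<otimes> (s \<otimes> v))"
        using assms(1) x(2) car v by algebra
    qed (use assms x car v in auto)
    finally have "x = frac a s \<oplus>\<^bsub>local_ring_at R I\<^esub> frac (c \<otimes> s \<ominus> a \<otimes> v) (s \<otimes> v)"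
      using x by simp
    moreover
    have "(c \<otimes> s \<ominus> a \<otimes> v) \<otimes> t \<ominus> b \<otimes> (s \<otimes> v) = c \<otimes> (s \<otimes> t) \<ominus> (a \<otimes> t \<oplus> b \<otimes> s) \<otimes> v"
    proof -
      have "(p \<ominus> q) \<ominus> r = p \<ominus> (q \<oplus> r)" if "p \<in> carrier R" "q \<in> carrier R" "r \<in> carrier R" for p q r
        using that by algebra
      moreover have "(c \<otimes> s \<ominus> a \<otimes> v) \<otimes> t = c \<otimes> (s \<otimes> t) \<ominus> a \<otimes> t \<otimes> v" "b \<otimes> (s \<otimes> v) = b \<otimes> s \<otimes> v"
        using assms(1,2) x(2) car v by algebra+
      ultimately show ?thesis
        using assms(1,2) x(2) car v by (simp add: l_distr)
    qed
    then have "frac (c \<otimes> s \<ominus> a \<otimes> v) (s \<otimes> v) \<in> residue_class b t"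
      using assms x(2-4) car v mult_compl[OF assms(3) x(3)] by (subst frac_mem_residue_class) auto
    ultimately show ?thesis
      unfolding set_add_def' using frac_self_mem[OF assms(1,3)] by auto
  qed
  ultimately show ?thesis
    unfolding residue_field_def FactRing_def ring.simps by (intro equalityI subsetI) auto
qed

lemma one_residue_class: "\<one>\<^bsub>residue_field R I\<^esub> = residue_class \<one> \<one>"
proof -
  have "\<one>\<^bsub>local_ring_at R I\<^esub> = frac \<one> \<one>"
    by (simp add: local_ring_at_def localization_def)
  then show ?thesis
    unfolding residue_field_def FactRing_def monoid.simps using coset_frac[of \<one> \<one>] one_compl by simp
qed

end

section \<open>Subrings and contraction of primes\<close>

locale subring_extension = cring S for S (structure) +
  fixes B :: "'a set"
  assumes subcring: "subcring B S"
begin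

abbreviation ring_B where "ring_B \<equiv> S\<lparr>carrier := B\<rparr>"

lemmas sub_closed [simp, intro] =
  subcringE(2)[OF subcring] subcringE(3)[OF subcring] subcringE(5)[OF subcring]
  subcringE(6)[OF subcring] subcringE(7)[OF subcring]

lemma sub_carrier [simp, intro]: "x \<in> B \<Longrightarrow> x \<in> carrier S"
  using subcringE(1)[OF subcring] by blast

lemma sub_minus [simp, intro]: "x \<in> B \<Longrightarrow> y \<in> B \<Longrightarrow> x \<ominus> y \<in> B"
  by (simp add: a_minus_def)

lemma sub_pow [simp, intro]: "x \<in> B \<Longrightarrow> x [^] (n::nat) \<in> B"
  by (induction n) auto

lemma cring_sub: "cring ring_B"
  using subcring subcring_iff subcringE(1) by blast

text \<open>Addition and multiplication of \<open>ring_B\<close> are literally those of S, but the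
  additive inverse is defined through the carrier; uniqueness of inverses identifies the two
  subtractions.\<close>

lemma minus_sub:
  assumes "a \<in> B" "b \<in> B"
  shows "a \<ominus>\<^bsub>ring_B\<^esub> b = a \<ominus> b"
proof -
  interpret B: cring ring_B
    by (rule cring_sub)
  have "\<ominus>\<^bsub>ring_B\<^esub> b = \<ominus> b"
    using B.sum_zero_eq_neg[of "\<ominus> b" b] assms(2) l_neg[of b] by auto
  then show ?thesis
    by (simp add: a_minus_def)
qed

text \<open>The hypotheses speak only of the operations of S. Closure under negation comes from
  multiplying by -1, which lies in B.\<close>

lemma ideal_subI:
  assumes "J \<subseteq> B" "\<zero> \<in> J" "\<And>x y. x \<in> J \<Longrightarrow> y \<in> J \<Longrightarrow> x \<oplus> y \<in> J"
    and "\<And>x b. x \<in> J \<Longrightarrow> b \<in> B \<Longrightarrow> b \<otimes> x \<in> J"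
  shows "ideal J ring_B"
proof -
  interpret B: cring ring_B
    by (rule cring_sub)
  have neg: "\<ominus>\<^bsub>ring_B\<^esub> x \<in> J" if "x \<in> J" for x
  proof -
    have "\<ominus>\<^bsub>ring_B\<^esub> x = (\<ominus>\<^bsub>ring_B\<^esub> \<one>) \<otimes> x"
      using B.l_minus[of \<one> x] that assms(1) by auto
    then show ?thesis
      using assms(4)[OF that, of "\<ominus>\<^bsub>ring_B\<^esub> \<one>"] B.a_inv_closed[of \<one>] by auto
  qed
  show ?thesis
  proof (rule idealI[OF B.ring_axioms])
    show "subgroup J (add_monoid ring_B)"
      using assms neg by (intro subgroup.intro) (auto simp: a_inv_def)
    show "x \<otimes>\<^bsub>ring_B\<^esub> a \<in> J" if "a \<in> J" "x \<in> carrier ring_B" for a x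
      using that assms(4) by simp
    show "a \<otimes>\<^bsub>ring_B\<^esub> x \<in> J" if "a \<in> J" "x \<in> carrier ring_B" for a x
      using that assms(1,4) m_comm[of a x] by (auto simp: subset_iff)
  qed
qed

lemma primeideal_contraction:
  assumes "primeideal Q S"
  shows "primeideal (Q \<inter> B) ring_B"
proof -
  interpret Q: primeideal Q S by fact
  show ?thesis
  proof (rule primeidealI[OF _ cring_sub])
    show "ideal (Q \<inter> B) ring_B"
      by (rule ideal_subI) (auto intro: Q.add_mem Q.I_l_closed)
    show "carrier ring_B \<noteq> Q \<inter> B"
      using Q.one_notin by auto
    show "a \<in> Q \<inter> B \<or> b \<in> Q \<inter> B"
      if "a \<in> carrier ring_B" "b \<in> carrier ring_B" "a \<otimes>\<^bsub>ring_B\<^esub> b \<in> Q \<inter> B" for a b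
      using that Q.I_prime[of a b] by auto
  qed
qed

end

section \<open>The residual extension at a prime\<close>

locale prime_of_extension = subring_extension S B + Q: primeideal Q S
  for S (structure) and B and Q
begin

sublocale P: primeideal "Q \<inter> B" ring_B
  by (intro primeideal_contraction Q.primeideal_axioms)

lemma P_compl: "P.compl = B - Q"
  by auto

lemma residue_map_class:
  assumes "a \<in> B" "s \<in> B - Q"
  shows "residue_map S Q (P.residue_class a s) = Q.residue_class a s"
proof -
  have *: "local_max_ideal S Q +>\<^bsub>local_ring_at S Q\<^esub> (frac_rel S Q.compl `` x) = Q.residue_class a s"
    if x: "x \<in> P.residue_class a s" for x
  proof -
    obtain b t where b: "x = P.frac b t" "b \<in> B" "t \<in> B - Q" "b \<otimes> s \<ominus>\<^bsub>ring_B\<^esub> a \<otimes> t \<in> Q \<inter> B"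
      using x by (rule P.residue_class_cases) auto
    have bt: "b \<in> carrier S" "t \<in> Q.compl"
      using b by auto
    have "(b, t) \<in> P.frac b t"
      using b by (intro P.self_mem_frac) auto
    \<comment> \<open>A multiplier u in B - Q that witnesses equality over B also witnesses it over
      S. Hence all representatives over B fall into one class over S, which is the image under
      \<open>frac_rel\<close> of S.\<close>
    moreover have "Q.frac b' t' = Q.frac b t" if "(b', t') \<in> P.frac b t" for b' t'
    proof -
      have "b' \<in> B" "t' \<in> B - Q" "P.frac b' t' = P.frac b t"
        using that b(2,3) P.mem_frac[of b t b' t'] by auto
      moreover obtain u where "u \<in> B - Q" "u \<otimes> (b' \<otimes> t) = u \<otimes> (b \<otimes> t')"
        using P.frac_eq_iff[of b' b t' t] calculation b by auto
      ultimately show ?thesis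
        using b by (subst Q.frac_eq_iff) auto
    qed
    ultimately have "frac_rel S Q.compl `` P.frac b t = Q.frac b t"
      unfolding fraction_def[of S] by fast
    moreover have "Q.residue_class b t = Q.residue_class a s"
      using b assms minus_sub[of "b \<otimes> s" "a \<otimes> t"] by (subst Q.residue_class_eq_iff) auto
    ultimately show ?thesis
      using Q.coset_frac[OF bt] b(1) by simp
  qed
  moreover have "P.frac a s \<in> P.residue_class a s"
    using assms by (intro P.frac_self_mem) auto
  ultimately show ?thesis
    unfolding residue_map_def by blast
qed

text \<open>The residual map is always an injective homomorphism, so only surjectivity is at stake.
  Surjectivity says that each y in S agrees modulo Q with a fraction r/t from B. In this form the
  condition visibly persists when B grows.\<close>

lemma residue_map_iso_iff:
  "residue_map S Q \<in> ring_iso (residue_field ring_B (Q \<inter> B)) (residue_field S Q)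
    \<longleftrightarrow> (\<forall>y\<in>carrier S. \<exists>r\<in>B. \<exists>t\<in>B - Q. t \<otimes> y \<ominus> r \<in> Q)"
proof
  assume "residue_map S Q \<in> ring_iso (residue_field ring_B (Q \<inter> B)) (residue_field S Q)"
  then have im: "residue_map S Q ` carrier (residue_field ring_B (Q \<inter> B)) = carrier (residue_field S Q)"
    by (simp add: ring_iso_def bij_betw_def)
  show "\<forall>y\<in>carrier S. \<exists>r\<in>B. \<exists>t\<in>B - Q. t \<otimes> y \<ominus> r \<in> Q"
  proof
    fix y assume y: "y \<in> carrier S"
    have "Q.residue_class y \<one> \<in> carrier (residue_field S Q)"
      unfolding Q.carrier_residue_field using y Q.one_compl by blast
    then obtain r t where rt: "r \<in> B" "t \<in> B - Q" "Q.residue_class y \<one> = residue_map S Q (P.residue_class r t)"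
      unfolding im[symmetric] P.carrier_residue_field by auto
    then have "Q.residue_class y \<one> = Q.residue_class r t"
      using residue_map_class by simp
    then have "y \<otimes> t \<ominus> r \<in> Q"
      using y rt Q.residue_class_eq_iff[of r y t \<one>] Q.one_compl by simp
    then show "\<exists>r\<in>B. \<exists>t\<in>B - Q. t \<otimes> y \<ominus> r \<in> Q"
      using y rt m_comm[of y t] by auto
  qed
next
  assume dense: "\<forall>y\<in>carrier S. \<exists>r\<in>B. \<exists>t\<in>B - Q. t \<otimes> y \<ominus> r \<in> Q"
  have "residue_map S Q \<in> ring_hom (residue_field ring_B (Q \<inter> B)) (residue_field S Q)"
  proof (rule ring_hom_memI)
    fix x assume "x \<in> carrier (residue_field ring_B (Q \<inter> B))"
    then obtain a s where x: "x = P.residue_class a s" "a \<in> B" "s \<in> B - Q"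
      by (auto simp: P.carrier_residue_field)
    then have mem: "a \<in> carrier S" "s \<in> Q.compl"
      by auto
    then show "residue_map S Q x \<in> carrier (residue_field S Q)"
      unfolding x(1) residue_map_class[OF x(2,3)] Q.carrier_residue_field by blast
    fix y assume "y \<in> carrier (residue_field ring_B (Q \<inter> B))"
    then obtain b t where y: "y = P.residue_class b t" "b \<in> B" "t \<in> B - Q"
      by (auto simp: P.carrier_residue_field)
    then have memy: "b \<in> carrier S" "t \<in> Q.compl"
      by auto
    have st: "s \<otimes> t \<in> B - Q"
      using x y Q.mult_compl[OF mem(2) memy(2)] by auto
    show "residue_map S Q (x \<otimes>\<^bsub>residue_field ring_B (Q \<inter> B)\<^esub> y)
        = residue_map S Q x \<otimes>\<^bsub>residue_field S Q\<^esub> residue_map S Q y"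
      using x y mem memy st P.mult_residue_class[of a b s t] Q.mult_residue_class[of a b s t]
      by (simp add: residue_map_class)
    show "residue_map S Q (x \<oplus>\<^bsub>residue_field ring_B (Q \<inter> B)\<^esub> y)
        = residue_map S Q x \<oplus>\<^bsub>residue_field S Q\<^esub> residue_map S Q y"
      using x y mem memy st P.add_residue_class[of a b s t] Q.add_residue_class[of a b s t]
      by (simp add: residue_map_class)
  next
    show "residue_map S Q \<one>\<^bsub>residue_field ring_B (Q \<inter> B)\<^esub> = \<one>\<^bsub>residue_field S Q\<^esub>"
      using P.one_residue_class Q.one_residue_class residue_map_class[of \<one> \<one>] Q.one_notin by simp
  qed
  moreover have "inj_on (residue_map S Q) (carrier (residue_field ring_B (Q \<inter> B)))"
  proof (rule inj_onI)
    fix x y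
    assume "x \<in> carrier (residue_field ring_B (Q \<inter> B))" "y \<in> carrier (residue_field ring_B (Q \<inter> B))"
      and eq: "residue_map S Q x = residue_map S Q y"
    then obtain a s b t where x: "x = P.residue_class a s" "a \<in> B" "s \<in> B - Q"
      and y: "y = P.residue_class b t" "b \<in> B" "t \<in> B - Q"
      by (auto simp: P.carrier_residue_field)
    have "Q.residue_class a s = Q.residue_class b t"
      using eq x y by (simp add: residue_map_class)
    then have "a \<otimes> t \<ominus> b \<otimes> s \<in> Q"
      using x y by (subst (asm) Q.residue_class_eq_iff) auto
    then show "x = y"
      using x y minus_sub[of "a \<otimes> t" "b \<otimes> s"] by (simp add: P.residue_class_eq_iff)
  qed
  moreover have "residue_map S Q ` carrier (residue_field ring_B (Q \<inter> B)) = carrier (residue_field S Q)"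
  proof
    show "residue_map S Q ` carrier (residue_field ring_B (Q \<inter> B)) \<subseteq> carrier (residue_field S Q)"
      using calculation(1) by (auto simp: ring_hom_def)
    show "carrier (residue_field S Q) \<subseteq> residue_map S Q ` carrier (residue_field ring_B (Q \<inter> B))"
    proof
      fix z assume "z \<in> carrier (residue_field S Q)"
      then obtain y s where z: "z = Q.residue_class y s" "y \<in> carrier S" "s \<in> carrier S" "s \<notin> Q"
        by (auto simp: Q.carrier_residue_field)
      \<comment> \<open>Numerator y and denominator s are approximated separately: t y = r and t' s
        = r' modulo Q. Since t' and s lie outside Q, so does r', and y/s becomes (r t')/(t
        r').\<close>
      obtain r t where rt: "r \<in> B" "t \<in> B" "t \<notin> Q" "t \<otimes> y \<ominus> r \<in> Q"
        using dense z by blast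
      obtain r' t' where rt': "r' \<in> B" "t' \<in> B" "t' \<notin> Q" "t' \<otimes> s \<ominus> r' \<in> Q"
        using dense z by blast
      have "r' \<notin> Q"
      proof
        assume "r' \<in> Q"
        then have "(t' \<otimes> s \<ominus> r') \<oplus> r' \<in> Q"
          using rt' Q.add_mem by blast
        moreover have "(t' \<otimes> s \<ominus> r') \<oplus> r' = t' \<otimes> s"
          using rt'(1,2) z(3) by (simp add: a_minus_def a_assoc l_neg)
        ultimately show False
          using Q.I_prime[of t' s] rt' z by auto
      qed
      have "r' \<otimes> (t \<otimes> y) \<ominus> r' \<otimes> r \<in> Q" "r \<otimes> (t' \<otimes> s) \<ominus> r \<otimes> r' \<in> Q"
        using rt rt' z by (auto intro!: Q.cong_mult)
      then have "r' \<otimes> (t \<otimes> y) \<ominus> r \<otimes> (t' \<otimes> s) \<in> Q"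
        using rt rt' z m_comm[of r r']
          Q.cong_trans[of "r' \<otimes> (t \<otimes> y)" "r' \<otimes> r" "r \<otimes> (t' \<otimes> s)"] Q.cong_sym[of "r \<otimes> (t' \<otimes> s)" "r' \<otimes> r"]
        by simp
      moreover have "r' \<otimes> (t \<otimes> y) = y \<otimes> (t \<otimes> r')" "r \<otimes> (t' \<otimes> s) = r \<otimes> t' \<otimes> s"
        using rt rt' z by (simp_all add: m_ac)
      moreover have tr: "t \<otimes> r' \<in> B - Q"
        using rt rt' \<open>r' \<notin> Q\<close> Q.I_prime[of t r'] by auto
      ultimately have "z = Q.residue_class (r \<otimes> t') (t \<otimes> r')"
        using z rt rt' by (simp add: Q.residue_class_eq_iff)
      then have "z = residue_map S Q (P.residue_class (r \<otimes> t') (t \<otimes> r'))"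
        using residue_map_class rt rt' tr by simp
      moreover have "P.residue_class (r \<otimes> t') (t \<otimes> r') \<in> carrier (residue_field ring_B (Q \<inter> B))"
        unfolding P.carrier_residue_field P_compl using rt rt' tr by auto
      ultimately show "z \<in> residue_map S Q ` carrier (residue_field ring_B (Q \<inter> B))"
        by blast
    qed
  qed
  ultimately show "residue_map S Q \<in> ring_iso (residue_field ring_B (Q \<inter> B)) (residue_field S Q)"
    by (simp add: ring_iso_def bij_betw_def)
qed

end

section \<open>Lying over and u-closedness\<close>

context cring
begin

lemma ideal_criterion:
  assumes "J \<subseteq> carrier R" "\<zero> \<in> J" "\<And>x y. x \<in> J \<Longrightarrow> y \<in> J \<Longrightarrow> x \<oplus> y \<in> J"
    and "\<And>x b. x \<in> J \<Longrightarrow> b \<in> carrier R \<Longrightarrow> b \<otimes> x \<in> J"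
  shows "ideal J R"
proof -
  interpret E: subring_extension R "carrier R"
    by (intro subring_extension.intro subring_extension_axioms.intro is_cring carrier_is_subcring)
  show ?thesis
    using E.ideal_subI[OF assms] by simp
qed

lemma ideal_adjoin:
  assumes "ideal J R" "x \<in> carrier R"
  shows "ideal {q \<oplus> x \<otimes> a | q a. q \<in> J \<and> a \<in> carrier R} R"
proof -
  interpret J: ideal J R by fact
  show ?thesis
  proof (rule ideal_criterion)
    show "{q \<oplus> x \<otimes> a | q a. q \<in> J \<and> a \<in> carrier R} \<subseteq> carrier R"
      using assms by auto
    have "\<zero> = \<zero> \<oplus> x \<otimes> \<zero>"
      using assms by simp
    then show "\<zero> \<in> {q \<oplus> x \<otimes> a | q a. q \<in> J \<and> a \<in> carrier R}"
      using J.zero_mem by blast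
  next
    fix y z assume "y \<in> {q \<oplus> x \<otimes> a | q a. q \<in> J \<and> a \<in> carrier R}"
      "z \<in> {q \<oplus> x \<otimes> a | q a. q \<in> J \<and> a \<in> carrier R}"
    then obtain q a r b where *: "y = q \<oplus> x \<otimes> a" "q \<in> J" "a \<in> carrier R"
      "z = r \<oplus> x \<otimes> b" "r \<in> J" "b \<in> carrier R"
      by blast
    have "y \<oplus> z = (q \<oplus> r) \<oplus> x \<otimes> (a \<oplus> b)"
      using * assms by (simp add: r_distr a_ac)
    then show "y \<oplus> z \<in> {q \<oplus> x \<otimes> a | q a. q \<in> J \<and> a \<in> carrier R}"
      using * J.add_mem by blast
  next
    fix y b assume "y \<in> {q \<oplus> x \<otimes> a | q a. q \<in> J \<and> a \<in> carrier R}" and b: "b \<in> carrier R"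
    then obtain q a where *: "y = q \<oplus> x \<otimes> a" "q \<in> J" "a \<in> carrier R"
      by blast
    have "b \<otimes> y = b \<otimes> q \<oplus> x \<otimes> (b \<otimes> a)"
      using * b assms by (simp add: r_distr m_ac)
    then show "b \<otimes> y \<in> {q \<oplus> x \<otimes> a | q a. q \<in> J \<and> a \<in> carrier R}"
      using * b J.I_l_closed by blast
  qed
qed

text \<open>Zorn's lemma gives an ideal Q maximal among those above F that miss D, and such an ideal
  is prime. The last conclusion records the maximality itself, which lying over uses again.\<close>

lemma exists_prime_avoiding:
  assumes F: "ideal F R" and D: "D \<subseteq> carrier R" "\<one> \<in> D" "\<And>x y. x \<in> D \<Longrightarrow> y \<in> D \<Longrightarrow> x \<otimes> y \<in> D"
    and disj: "F \<inter> D = {}"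
  obtains Q where "primeideal Q R" "F \<subseteq> Q" "Q \<inter> D = {}"
    "\<And>x. x \<in> carrier R - Q \<Longrightarrow> \<exists>q\<in>Q. \<exists>a\<in>carrier R. q \<oplus> x \<otimes> a \<in> D"
proof -
  let ?A = "{J. ideal J R \<and> F \<subseteq> J \<and> J \<inter> D = {}}"
  have "\<Union>C \<in> ?A" if C: "C \<noteq> {}" "subset.chain ?A C" for C
  proof -
    have mem: "ideal J R" "F \<subseteq> J" "J \<inter> D = {}" if "J \<in> C" for J
      using C that by (auto simp: subset.chain_def)
    have "ideal (\<Union>C) R"
    proof (rule ideal_criterion)
      show "\<Union>C \<subseteq> carrier R"
        using ideal.Icarr[OF mem(1)] by blast
      show "\<zero> \<in> \<Union>C"
        using C(1) ideal.zero_mem[OF mem(1)] by blast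
      show "x \<oplus> y \<in> \<Union>C" if xy: "x \<in> \<Union>C" "y \<in> \<Union>C" for x y
      proof -
        obtain J K where "J \<in> C" "K \<in> C" "x \<in> J" "y \<in> K"
          using xy by blast
        moreover have "J \<subseteq> K \<or> K \<subseteq> J"
          using C(2) calculation unfolding subset_chain_def by blast
        ultimately obtain L where L: "L \<in> C" "x \<in> L" "y \<in> L"
          by blast
        then show ?thesis
          using ideal.add_mem[OF mem(1)[OF L(1)]] by blast
      qed
      show "b \<otimes> x \<in> \<Union>C" if x: "x \<in> \<Union>C" "b \<in> carrier R" for x b
      proof -
        obtain J where "J \<in> C" "x \<in> J"
          using x by blast
        then show ?thesis
          using ideal.I_l_closed[OF mem(1), of J x b] x(2) by blast
      qed
    qed
    then show ?thesis
      using mem C(1) by blast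
  qed
  moreover have "?A \<noteq> {}"
    using F disj by blast
  ultimately have "\<exists>Q\<in>?A. \<forall>J\<in>?A. Q \<subseteq> J \<longrightarrow> J = Q"
    by (intro subset_Zorn_nonempty)
  then obtain Q where Q: "Q \<in> ?A" and max': "\<forall>J\<in>?A. Q \<subseteq> J \<longrightarrow> J = Q"
    by (rule bexE)
  have max: "J = Q" if J: "J \<in> ?A" "Q \<subseteq> J" for J
    by (rule mp[OF bspec[OF max' J(1)] J(2)])
  interpret Q: ideal Q R
    using Q by simp
  have ex: "\<exists>q\<in>Q. \<exists>a\<in>carrier R. q \<oplus> x \<otimes> a \<in> D" if x: "x \<in> carrier R - Q" for x
  \<comment> \<open>Otherwise the ideal Q + xR would still miss D and would be strictly larger than
    Q.\<close>
  proof (rule ccontr)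
    let ?J = "{q \<oplus> x \<otimes> a | q a. q \<in> Q \<and> a \<in> carrier R}"
    assume "\<not> ?thesis"
    then have "?J \<inter> D = {}"
      by blast
    moreover have "ideal ?J R"
      using x by (intro ideal_adjoin Q.ideal_axioms) auto
    moreover have "q \<in> ?J" if "q \<in> Q" for q
    proof -
      have "q = q \<oplus> x \<otimes> \<zero>"
        using that x by simp
      then show ?thesis
        using that by blast
    qed
    ultimately have "?J \<in> ?A" "Q \<subseteq> ?J"
      using Q by auto
    then have "?J = Q"
      by (rule max)
    moreover have "\<zero> \<oplus> x \<otimes> \<one> \<in> ?J"
      using Q.zero_mem one_closed by blast
    ultimately show False
      using x by auto
  qed
  have "primeideal Q R"
  proof (rule primeidealI[OF Q.ideal_axioms is_cring])
    show "carrier R \<noteq> Q"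
      using D Q by auto
    fix x y assume xy: "x \<in> carrier R" "y \<in> carrier R" "x \<otimes> y \<in> Q"
    show "x \<in> Q \<or> y \<in> Q"
    proof (rule ccontr)
      assume "\<not> ?thesis"
      then obtain q a r b where *: "q \<in> Q" "a \<in> carrier R" "q \<oplus> x \<otimes> a \<in> D"
        "r \<in> Q" "b \<in> carrier R" "r \<oplus> y \<otimes> b \<in> D"
        using ex xy by (metis DiffI)
      \<comment> \<open>Both factors lie in D, hence so does their product; but every term of its
        expansion lies in Q, the last one through x y.\<close>
      have "(q \<oplus> x \<otimes> a) \<otimes> (r \<oplus> y \<otimes> b) = (r \<oplus> y \<otimes> b) \<otimes> q \<oplus> ((x \<otimes> a) \<otimes> r \<oplus> (a \<otimes> b) \<otimes> (x \<otimes> y))"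
        using * xy(1,2) by (simp add: l_distr r_distr m_ac a_ac)
      also have "\<dots> \<in> Q"
        using * xy by (intro Q.add_mem Q.I_l_closed[OF xy(3)] Q.I_l_closed[of q] Q.I_l_closed[of r]) auto
      finally show False
        using * D(3) Q by blast
    qed
  qed
  then show thesis
    using that Q ex by blast
qed

end

section \<open>Lying over for integral extensions\<close>

context subring_extension
begin

definition integral where
  "integral \<longleftrightarrow> (\<forall>x\<in>carrier S. \<exists>p. set p \<subseteq> B \<and> eval (\<one> # p) x = \<zero>)"

text \<open>Take Q maximal among the ideals of S that miss B - N. Then Q meets B inside N, and only
  the inclusion of N in Q is at issue. If some a in N were outside Q, maximality would put t = q + a
  s into B - N, and an integral equation of s would force a power of t into N.\<close>

lemma lying_over:
  assumes int: "integral" and N: "primeideal N ring_B"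
  obtains Q where "primeideal Q S" "Q \<inter> B = N"
proof -
  interpret N: primeideal N ring_B by fact
  have NB: "x \<in> B" if "x \<in> N" for x
    using N.Icarr that by auto
  have "{\<zero>} \<inter> (B - N) = {}"
    using N.zero_mem by auto
  moreover have "B - N \<subseteq> carrier S" "\<one> \<in> B - N"
    using N.one_notin by auto
  moreover have "x \<otimes> y \<in> B - N" if "x \<in> B - N" "y \<in> B - N" for x y
    using N.mult_compl[of x y] that by simp
  ultimately obtain Q where Q: "primeideal Q S" "Q \<inter> (B - N) = {}"
    and ex: "\<And>x. x \<in> carrier S - Q \<Longrightarrow> \<exists>q\<in>Q. \<exists>a\<in>carrier S. q \<oplus> x \<otimes> a \<in> B - N"
    using exists_prime_avoiding[OF zeroideal, of "B - N"] by metis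
  interpret Q: primeideal Q S by fact
  have "N \<subseteq> Q"
  proof
    fix a assume aN: "a \<in> N"
    have a: "a \<in> B"
      using NB aN .
    show "a \<in> Q"
    proof (rule ccontr)
      assume "a \<notin> Q"
      then obtain q s where qs: "q \<in> Q" "s \<in> carrier S" "q \<oplus> a \<otimes> s \<in> B - N"
        using ex a by blast
      define t where "t = q \<oplus> a \<otimes> s"
      have t: "t \<in> B" "t \<notin> N"
        using qs t_def by auto
      have "a \<otimes> s \<ominus> t = \<ominus> q"
        using qs a unfolding t_def by (simp add: a_minus_def minus_add a_ac r_neg)
      then have cong_t: "a \<otimes> s \<ominus> t \<in> Q"
        using qs by simp
      \<comment> \<open>Multiplying an integral equation of \<open>s\<close> by \<open>a\<^sup>n\<close> gives \<open>t\<^sup>n \<in> N\<close>, since \<open>a s \<equiv> t\<close> modulo \<open>Q\<close>.\<close>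
      have "set p \<subseteq> B \<Longrightarrow> \<exists>m\<in>N. a [^] length p \<otimes> eval (\<one> # p) s \<ominus> (t [^] length p \<oplus> m) \<in> Q" for p
      proof (induction p rule: rev_induct)
        case Nil
        have "\<one> \<otimes> (\<one> \<otimes> \<one> \<oplus> \<zero>) \<ominus> (\<one> \<oplus> \<zero>) \<in> Q"
          by (simp add: a_minus_def r_neg)
        then show ?case
          using N.zero_mem by (intro bexI[of _ \<zero>]) auto
      next
        case (snoc c p)
        then obtain m where m: "m \<in> N" "a [^] length p \<otimes> eval (\<one> # p) s \<ominus> (t [^] length p \<oplus> m) \<in> Q"
          by auto
        define e where "e = eval (\<one> # p) s"
        have c: "c \<in> B" and p: "set (\<one> # p) \<subseteq> carrier S"
          using snoc.prems by auto
        then have e: "e \<in> carrier S"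
          unfolding e_def using qs by (intro eval_in_carrier) auto
        have ev: "eval (\<one> # p @ [c]) s = e \<otimes> s \<oplus> c"
          using eval_append_aux[OF p, of c s] c qs e_def by simp
        \<comment> \<open>Appending the coefficient c turns the value e into e s + c. The congruence
          of a s with t raises the exponents of a and t by one, and the new term \<open>?k\<close>
          joins the part in N because a lies in N.\<close>
        let ?n = "length p" and ?k = "a [^] length p \<otimes> a \<otimes> c"
        have mB: "m \<in> B"
          using NB m by blast
        have "(a [^] ?n \<otimes> e) \<otimes> (a \<otimes> s) \<ominus> (t [^] ?n \<oplus> m) \<otimes> t \<in> Q"
          using m cong_t mB t a e qs unfolding e_def by (intro Q.cong_mult2) auto
        then have "((a [^] ?n \<otimes> e) \<otimes> (a \<otimes> s) \<oplus> ?k) \<ominus> ((t [^] ?n \<oplus> m) \<otimes> t \<oplus> ?k) \<in> Q"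
          using mB t a e c qs by (intro Q.cong_add) (auto simp: a_minus_def r_neg)
        moreover have "(a [^] ?n \<otimes> e) \<otimes> (a \<otimes> s) \<oplus> ?k = a [^] Suc ?n \<otimes> (e \<otimes> s \<oplus> c)"
          using a e c qs by (simp add: r_distr m_ac)
        moreover have "(t [^] ?n \<oplus> m) \<otimes> t \<oplus> ?k = t [^] Suc ?n \<oplus> (m \<otimes> t \<oplus> ?k)"
          using mB t a c by (simp add: l_distr a_assoc)
        moreover have "m \<otimes> t \<oplus> ?k \<in> N"
          using m t a c aN N.I_r_closed[of m t] N.I_l_closed[of a "a [^] ?n \<otimes> c"]
            N.add_mem[of "m \<otimes> t" ?k] by (simp add: m_ac)
        ultimately show ?case
          unfolding append_Cons ev length_append by auto
      qed
      moreover obtain p where p: "set p \<subseteq> B" "eval (\<one> # p) s = \<zero>"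
        using int qs unfolding integral_def by blast
      ultimately obtain m where m: "m \<in> N" "a [^] length p \<otimes> \<zero> \<ominus> (t [^] length p \<oplus> m) \<in> Q"
        by metis
      have mB: "m \<in> B"
        using NB m by blast
      have "\<ominus> (\<zero> \<ominus> (t [^] length p \<oplus> m)) \<in> Q"
        using m a by simp
      then have "t [^] length p \<oplus> m \<in> Q"
        using t mB by (simp add: a_minus_def)
      then have "t [^] length p \<oplus> m \<in> N"
        using Q(2) t mB by blast
      moreover have "\<ominus> m \<in> N"
      proof -
        have "(\<ominus> \<one>) \<otimes> m \<in> N"
          using N.I_l_closed[of m "\<ominus> \<one>"] m by auto
        then show ?thesis
          using mB by (simp add: l_minus)
      qed
      ultimately have "(t [^] length p \<oplus> m) \<oplus> \<ominus> m \<in> N"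
        using N.add_mem[of "t [^] length p \<oplus> m" "\<ominus> m"] by simp
      then have "t [^] length p \<in> N"
        using t mB by (simp add: a_assoc r_neg)
      moreover have "t [^] n \<notin> N" for n :: nat
      proof (induction n)
        case 0
        then show ?case using N.one_notin by simp
      next
        case (Suc n)
        then show ?case
          using N.I_prime[of "t [^] n" t] t by auto
      qed
      ultimately show False
        by blast
    qed
  qed
  then have "Q \<inter> B = N"
    using Q(2) NB by auto
  then show thesis
    using that Q(1) by blast
qed

text \<open>Here \<open>cond\<close> places all w in B with w b in B inside M. Modulo M + B b the
  ring B + B b reduces to B/M, with b going to 0; hence M + B b is prime, and lying over extends it
  to S.\<close>

lemma exists_prime_over:
  assumes int: "integral" and b: "b \<in> carrier S"
    and x: "b \<otimes> b \<ominus> b \<in> B" and xb: "(b \<otimes> b \<ominus> b) \<otimes> b \<in> B"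
    and M: "primeideal M ring_B" and cond: "\<And>w. w \<in> B \<Longrightarrow> w \<otimes> b \<in> B \<Longrightarrow> w \<in> M"
  obtains Q where "primeideal Q S" "Q \<inter> B = M" "b \<in> Q"
proof -
  interpret M: primeideal M ring_B by fact
  have MB [simp]: "m \<in> B" if "m \<in> M" for m
    using M.Icarr that by auto
  have M_mult [simp]: "w \<otimes> m \<in> M" if "m \<in> M" "w \<in> B" for m w
    using M.I_l_closed[of m w] that by simp
  have M_add [simp]: "m \<oplus> n \<in> M" if "m \<in> M" "n \<in> M" for m n
    using M.add_mem[of m n] that by simp
  define x where "x = b \<otimes> b \<ominus> b"
  \<comment> \<open>Both conditions on b enter here: x = b^2 - b and x b lie in B, so
    \<open>cond\<close> puts x into M.\<close>
  have xM: "x \<in> M"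
    using cond x xb x_def by simp
  have bb: "b \<otimes> b = b \<oplus> x"
    using b unfolding x_def by (simp add: a_minus_def a_ac r_neg2)
  \<comment> \<open>T is B[b]: the relation b^2 = b + x reduces every product to the form w + v b. N
    is the prime of T that is to be lifted.\<close>
  define T where "T = {w \<oplus> v \<otimes> b | w v. w \<in> B \<and> v \<in> B}"
  define N where "N = {m \<oplus> v \<otimes> b | m v. m \<in> M \<and> v \<in> B}"
  have TI: "w \<oplus> v \<otimes> b \<in> T" if "w \<in> B" "v \<in> B" for w v
    using that T_def by blast
  have NI: "w \<oplus> v \<otimes> b \<in> N" if "w \<in> M" "v \<in> B" for w v
    using that N_def by blast
  have add: "(w \<oplus> v \<otimes> b) \<oplus> (w' \<oplus> v' \<otimes> b) = (w \<oplus> w') \<oplus> (v \<oplus> v') \<otimes> b"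
    if "w \<in> B" "v \<in> B" "w' \<in> B" "v' \<in> B" for w v w' v'
    using that b by (simp add: l_distr a_ac)
  have mult: "(w \<oplus> v \<otimes> b) \<otimes> (w' \<oplus> v' \<otimes> b)
      = (w \<otimes> w' \<oplus> v \<otimes> v' \<otimes> x) \<oplus> (w \<otimes> v' \<oplus> v \<otimes> w' \<oplus> v \<otimes> v') \<otimes> b"
    if "w \<in> B" "v \<in> B" "w' \<in> B" "v' \<in> B" for w v w' v'
  proof -
    have "(w \<oplus> v \<otimes> b) \<otimes> (w' \<oplus> v' \<otimes> b)
        = w \<otimes> w' \<oplus> w \<otimes> v' \<otimes> b \<oplus> v \<otimes> w' \<otimes> b \<oplus> v \<otimes> v' \<otimes> (b \<otimes> b)"
      using that b by (simp add: l_distr r_distr m_ac a_ac)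
    also have "\<dots> = (w \<otimes> w' \<oplus> v \<otimes> v' \<otimes> x) \<oplus> (w \<otimes> v' \<oplus> v \<otimes> w' \<oplus> v \<otimes> v') \<otimes> b"
      unfolding bb using that b xM by (simp add: l_distr r_distr m_ac a_ac)
    finally show ?thesis .
  qed
  have BT: "w \<in> T" if "w \<in> B" for w
    using TI[OF that, of \<zero>] that b by simp
  have "subcring T S"
  proof (rule subcringI', rule subringI)
    show "T \<subseteq> carrier S"
      using b T_def by auto
    show "\<one> \<in> T"
      using BT by simp
    fix h assume "h \<in> T"
    then obtain w v where h: "h = w \<oplus> v \<otimes> b" "w \<in> B" "v \<in> B"
      unfolding T_def by blast
    have "\<ominus> h = \<ominus> w \<oplus> (\<ominus> v) \<otimes> b"
      using h b by (simp add: minus_add l_minus)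
    then show "\<ominus> h \<in> T"
      using h TI by simp
    fix k assume "k \<in> T"
    then obtain w' v' where k: "k = w' \<oplus> v' \<otimes> b" "w' \<in> B" "v' \<in> B"
      unfolding T_def by blast
    show "h \<oplus> k \<in> T"
      unfolding h(1) k(1) add[OF h(2,3) k(2,3)] using h k by (intro TI) auto
    show "h \<otimes> k \<in> T"
      unfolding h(1) k(1) mult[OF h(2,3) k(2,3)] using h k xM by (intro TI) auto
  qed
  then interpret T: subring_extension S T
    by (intro subring_extension.intro subring_extension_axioms.intro cring_axioms)
  \<comment> \<open>If m + v b lies in B then so do v b and (v b) b = v b + v x. Two uses of
    \<open>cond\<close> put first v and then v b into M.\<close>
  have contr: "n \<in> M" if nN: "n \<in> N" "n \<in> B" for n
  proof -
    obtain m v where n: "n = m \<oplus> v \<otimes> b" "m \<in> M" "v \<in> B"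
      using nN N_def by blast
    have "v \<otimes> b = n \<ominus> m"
      using n b by (simp add: a_minus_def a_ac r_neg r_neg1 r_neg2)
    then have vb: "v \<otimes> b \<in> B"
      using nN(2) n(2) by simp
    then have v: "v \<in> M"
      using cond n by blast
    have "v \<otimes> b \<otimes> b = v \<otimes> b \<oplus> v \<otimes> x"
      using bb n b xM by (simp add: m_assoc r_distr)
    moreover have "v \<otimes> x \<in> B"
      using n xM by simp
    ultimately have "v \<otimes> b \<otimes> b \<in> B"
      using sub_closed(5)[OF vb] by metis
    then have "v \<otimes> b \<in> M"
      by (rule cond[OF vb])
    then show ?thesis
      using n by simp
  qed
  have "primeideal N T.ring_B"
  proof (rule primeidealI[OF _ T.cring_sub])
    show "ideal N T.ring_B"
    proof (rule T.ideal_subI)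
      show "N \<subseteq> T"
        unfolding N_def T_def using MB by blast
      show "\<zero> \<in> N"
        using NI[of \<zero> \<zero>] M.zero_mem b by simp
      show "y \<oplus> z \<in> N" if yz: "y \<in> N" "z \<in> N" for y z
      proof -
        obtain w v where h: "y = w \<oplus> v \<otimes> b" "w \<in> M" "v \<in> B"
          using yz unfolding N_def by blast
        obtain w' v' where k: "z = w' \<oplus> v' \<otimes> b" "w' \<in> M" "v' \<in> B"
          using yz unfolding N_def by blast
        show ?thesis
          unfolding h(1) k(1) add[OF MB[OF h(2)] h(3) MB[OF k(2)] k(3)] using h k by (intro NI) auto
      qed
      show "y \<otimes> z \<in> N" if yz: "z \<in> N" "y \<in> T" for z y
      proof -
        obtain w v where h: "y = w \<oplus> v \<otimes> b" "w \<in> B" "v \<in> B"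
          using yz unfolding T_def by blast
        obtain w' v' where k: "z = w' \<oplus> v' \<otimes> b" "w' \<in> M" "v' \<in> B"
          using yz unfolding N_def by blast
        show ?thesis
          unfolding h(1) k(1) mult[OF h(2,3) MB[OF k(2)] k(3)] using h k xM by (intro NI) auto
      qed
    qed
    show "carrier T.ring_B \<noteq> N"
      using contr[of \<one>] M.one_notin BT[of \<one>] sub_closed(2) by fastforce
    fix y z assume yz: "y \<in> carrier T.ring_B" "z \<in> carrier T.ring_B" "y \<otimes>\<^bsub>T.ring_B\<^esub> z \<in> N"
    obtain w v where h: "y = w \<oplus> v \<otimes> b" "w \<in> B" "v \<in> B"
      using yz unfolding T_def by auto
    obtain w' v' where k: "z = w' \<oplus> v' \<otimes> b" "w' \<in> B" "v' \<in> B"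
      using yz unfolding T_def by auto
    define c where "c = w \<otimes> v' \<oplus> v \<otimes> w' \<oplus> v \<otimes> v'"
    have c: "c \<in> B"
      using h k c_def by simp
    obtain m u where mu: "(w \<otimes> w' \<oplus> v \<otimes> v' \<otimes> x) \<oplus> c \<otimes> b = m \<oplus> u \<otimes> b" "m \<in> M" "u \<in> B"
      using yz mult[OF h(2,3) k(2,3)] unfolding h(1) k(1) N_def c_def by auto
    \<comment> \<open>Comparing the two expressions for the product leaves its constant term as an
      element of both N and B, so \<open>contr\<close> applies. The term v v' x is in M, which
      leaves w w' and the primality of M.\<close>
    have "w \<otimes> w' \<oplus> v \<otimes> v' \<otimes> x = ((w \<otimes> w' \<oplus> v \<otimes> v' \<otimes> x) \<oplus> c \<otimes> b) \<oplus> (\<ominus> c) \<otimes> b"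
      using h k c xM b by (simp add: l_minus a_assoc r_neg)
    also have "\<dots> = m \<oplus> (u \<oplus> \<ominus> c) \<otimes> b"
      unfolding mu(1) using mu c b by (simp add: l_distr a_assoc)
    also have "\<dots> \<in> N"
      using mu c by (intro NI) auto
    finally have "w \<otimes> w' \<oplus> v \<otimes> v' \<otimes> x \<in> M"
      using contr h k xM by auto
    moreover have "(\<ominus> (v \<otimes> v')) \<otimes> x \<in> M"
      using h k xM by (intro M_mult) auto
    ultimately have "(w \<otimes> w' \<oplus> v \<otimes> v' \<otimes> x) \<oplus> (\<ominus> (v \<otimes> v')) \<otimes> x \<in> M"
      by (rule M_add)
    then have "w \<otimes> w' \<in> M"
      using h k xM by (simp add: l_minus a_assoc r_neg)
    then have "w \<in> M \<or> w' \<in> M"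
      using M.I_prime[of w w'] h k by simp
    then show "y \<in> N \<or> z \<in> N"
      using h k NI by blast
  qed
  moreover have "T.integral"
    using int BT unfolding T.integral_def integral_def by blast
  ultimately obtain Q where Q: "primeideal Q S" "Q \<inter> T = N"
    using T.lying_over by blast
  have "m \<in> N" if "m \<in> M" for m
    using NI[OF that, of \<zero>] that b by simp
  then have "Q \<inter> B = M"
    using Q(2) BT contr by (auto simp: set_eq_iff)
  moreover have "b \<in> Q"
    using NI[of \<zero> \<one>] M.zero_mem b Q(2) by auto
  ultimately show thesis
    using that Q(1) by blast
qed

section \<open>Injectivity on spectra implies u-closedness\<close>

lemma square_minus_self_one_minus:
  assumes "b \<in> carrier S"
  shows "(\<one> \<ominus> b) \<otimes> (\<one> \<ominus> b) \<ominus> (\<one> \<ominus> b) = b \<otimes> b \<ominus> b"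
proof -
  have "(\<one> \<ominus> b) \<otimes> (\<one> \<ominus> b) = (\<one> \<ominus> b) \<ominus> (\<one> \<ominus> b) \<otimes> b"
    using assms by (simp add: a_minus_def r_distr r_minus)
  moreover have "(\<one> \<ominus> b) \<otimes> b = b \<ominus> b \<otimes> b"
    using assms by (simp add: a_minus_def l_distr l_minus)
  ultimately show ?thesis
    using assms by algebra
qed

lemma u_closed_if_inj_Spec:
  assumes int: "integral" and inj: "inj_on (\<lambda>Q. Q \<inter> B) (Spec S)"
  shows "u_closed B S"
  unfolding u_closed_def ring_extension_def
proof (intro conjI ballI impI cring_axioms subcring)
  fix b assume b: "b \<in> carrier S"
    and h: "b [^] (2::nat) \<ominus> b \<in> B \<and> b [^] (3::nat) \<ominus> b [^] (2::nat) \<in> B"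
  have pow: "b [^] (2::nat) = b \<otimes> b" "b [^] (3::nat) = b \<otimes> b \<otimes> b"
    using b by (simp_all add: numeral_eq_Suc)
  have x: "b \<otimes> b \<ominus> b \<in> B"
    using h pow by simp
  have "(b \<otimes> b \<ominus> b) \<otimes> b = b \<otimes> b \<otimes> b \<ominus> b \<otimes> b"
    using b by (simp add: a_minus_def l_distr l_minus)
  then have xb: "(b \<otimes> b \<ominus> b) \<otimes> b \<in> B"
    using h pow by simp
  show "b \<in> B"
  proof (rule ccontr)
    assume "b \<notin> B"
    \<comment> \<open>F is proper exactly because b is not in B, so it lies in a prime M; the
      inclusion of F in M is the condition \<open>cond\<close> of
      \<open>exists_prime_over\<close>.\<close>
    define F where "F = {w \<in> B. w \<otimes> b \<in> B}"
    interpret RB: cring ring_B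
      by (rule cring_sub)
    have "ideal F ring_B"
      unfolding F_def using b by (intro ideal_subI) (auto simp: l_distr m_assoc)
    moreover have "F \<inter> {\<one>} = {}"
      using \<open>b \<notin> B\<close> b F_def by auto
    ultimately obtain M where M: "primeideal M ring_B" "F \<subseteq> M"
      by (elim RB.exists_prime_avoiding[of F "{\<one>}"]) auto
    interpret M: primeideal M ring_B by (rule M(1))
    obtain Q where Q: "primeideal Q S" "Q \<inter> B = M" "b \<in> Q"
      using exists_prime_over[OF int b x xb M(1)] M(2) F_def by blast
    \<comment> \<open>The assumptions on b are symmetric under b -> 1 - b. A second application
      gives a prime above the same M containing 1 - b; injectivity makes it equal to Q, which would
      then contain 1.\<close>
    let ?c = "\<one> \<ominus> b"
    have c: "?c \<in> carrier S"
      using b by simp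
    have x': "?c \<otimes> ?c \<ominus> ?c \<in> B"
      using x square_minus_self_one_minus[OF b] by simp
    have "(?c \<otimes> ?c \<ominus> ?c) \<otimes> ?c = (b \<otimes> b \<ominus> b) \<ominus> (b \<otimes> b \<ominus> b) \<otimes> b"
    proof -
      have "y \<otimes> ?c = y \<ominus> y \<otimes> b" if "y \<in> carrier S" for y
        using that b by (simp add: minus_eq r_distr r_minus)
      then show ?thesis
        using square_minus_self_one_minus[OF b] b by simp
    qed
    then have xc: "(?c \<otimes> ?c \<ominus> ?c) \<otimes> ?c \<in> B"
      using x xb by simp
    have "w \<in> M" if w: "w \<in> B" "w \<otimes> ?c \<in> B" for w
    proof -
      have "w \<otimes> b = w \<ominus> w \<otimes> ?c"
        using sub_carrier[OF w(1)] b by algebra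
      then show ?thesis
        using w M(2) F_def by auto
    qed
    then obtain Q' where Q': "primeideal Q' S" "Q' \<inter> B = M" "?c \<in> Q'"
      using exists_prime_over[OF int c x' xc M(1)] by blast
    interpret Q': primeideal Q' S by (rule Q'(1))
    have "Q = Q'"
      using inj_onD[OF inj, of Q Q'] Q Q' by (simp add: Spec_def)
    then have "?c \<oplus> b \<in> Q'"
      using Q Q' Q'.add_mem by blast
    then show False
      using Q'.one_notin b by (simp add: a_minus_def a_assoc l_neg)
  qed
qed

end

section \<open>Finiteness and Nakayama\<close>

context cring
begin

text \<open>Coefficients range over an arbitrary set K, so that one notion serves both for B-modules
  (K = B) and for products with an ideal (K = I).\<close>

primrec lin_span :: "'a set \<Rightarrow> 'a list \<Rightarrow> 'a set" where
  "lin_span K [] = {\<zero>}"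
| "lin_span K (g # gs) = {k \<otimes> g \<oplus> x | k x. k \<in> K \<and> x \<in> lin_span K gs}"

lemma lin_span_ConsI: "k \<in> K \<Longrightarrow> x \<in> lin_span K gs \<Longrightarrow> k \<otimes> g \<oplus> x \<in> lin_span K (g # gs)"
  by auto

text \<open>The induction principle for spans: later closure properties are proved by taking for Y
  the set of elements that have the property.\<close>

lemma lin_span_least:
  assumes "\<zero> \<in> Y" "\<And>x y. x \<in> Y \<Longrightarrow> y \<in> Y \<Longrightarrow> x \<oplus> y \<in> Y"
    and "\<And>k g. k \<in> K \<Longrightarrow> g \<in> set gs \<Longrightarrow> k \<otimes> g \<in> Y"
  shows "lin_span K gs \<subseteq> Y"
  using assms(3)
proof (induction gs)
  case Nil
  then show ?case using assms(1) by simp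
next
  case (Cons g gs)
  then show ?case using assms(2) by fastforce
qed

lemma lin_span_carrier:
  assumes "K \<subseteq> carrier R" "set gs \<subseteq> carrier R"
  shows "lin_span K gs \<subseteq> carrier R"
  using assms by (intro lin_span_least) auto

lemma zero_lin_span:
  assumes "\<zero> \<in> K" "set gs \<subseteq> carrier R"
  shows "\<zero> \<in> lin_span K gs"
  using assms(2)
proof (induction gs)
  case (Cons g gs)
  then show ?case
    using lin_span_ConsI[OF assms(1), of \<zero> gs g] by simp
qed simp

lemma lin_span_base:
  assumes "K \<subseteq> carrier R" "\<zero> \<in> K" "set gs \<subseteq> carrier R" "k \<in> K" "g \<in> set gs"
  shows "k \<otimes> g \<in> lin_span K gs"
  using assms(3,5)
proof (induction gs)
  case (Cons h gs)
  show ?case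
  proof (cases "g = h")
    case True
    have "k \<otimes> h \<in> carrier R"
      using assms Cons.prems by auto
    then show ?thesis
      using True lin_span_ConsI[OF assms(4) zero_lin_span[OF assms(2), of gs], of h] Cons.prems by simp
  next
    case False
    then have mem: "k \<otimes> g \<in> lin_span K gs"
      using Cons by auto
    moreover have "k \<otimes> g \<in> carrier R" "h \<in> carrier R"
      using assms Cons.prems by auto
    ultimately show ?thesis
      using lin_span_ConsI[OF assms(2) mem, of h] by simp
  qed
qed simp

lemma lin_span_add:
  assumes K: "K \<subseteq> carrier R" "\<And>k l. k \<in> K \<Longrightarrow> l \<in> K \<Longrightarrow> k \<oplus> l \<in> K"
    and "set gs \<subseteq> carrier R" "x \<in> lin_span K gs" "y \<in> lin_span K gs"
  shows "x \<oplus> y \<in> lin_span K gs"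
  using assms(3-)
proof (induction gs arbitrary: x y)
  case (Cons g gs)
  obtain k x' where x: "x = k \<otimes> g \<oplus> x'" "k \<in> K" "x' \<in> lin_span K gs"
    using Cons.prems(2) by auto
  obtain l y' where y: "y = l \<otimes> g \<oplus> y'" "l \<in> K" "y' \<in> lin_span K gs"
    using Cons.prems(3) by auto
  have "k \<in> carrier R" "l \<in> carrier R" "g \<in> carrier R" "x' \<in> carrier R" "y' \<in> carrier R"
    using x y K(1) Cons.prems(1) lin_span_carrier[of K gs] by auto
  then have "x \<oplus> y = (k \<oplus> l) \<otimes> g \<oplus> (x' \<oplus> y')"
    unfolding x(1) y(1) by (simp add: l_distr a_ac)
  moreover have "x' \<oplus> y' \<in> lin_span K gs"
    using Cons x y by auto
  ultimately show ?case
    using lin_span_ConsI[OF K(2)[OF x(2) y(2)]] by metis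
qed simp

lemma lin_span_smult:
  assumes "K \<subseteq> carrier R" "b \<in> carrier R" "\<And>k. k \<in> K \<Longrightarrow> b \<otimes> k \<in> K"
    and "set gs \<subseteq> carrier R" "x \<in> lin_span K gs"
  shows "b \<otimes> x \<in> lin_span K gs"
  using assms(4-)
proof (induction gs arbitrary: x)
  case (Cons g gs)
  obtain k x' where x: "x = k \<otimes> g \<oplus> x'" "k \<in> K" "x' \<in> lin_span K gs"
    using Cons.prems(2) by auto
  have "k \<in> carrier R" "g \<in> carrier R" "x' \<in> carrier R"
    using x assms(1) Cons.prems(1) lin_span_carrier[of K gs] by auto
  then have "b \<otimes> x = (b \<otimes> k) \<otimes> g \<oplus> b \<otimes> x'"
    unfolding x(1) using assms(2) by (simp add: r_distr m_ac)
  moreover have "b \<otimes> x' \<in> lin_span K gs"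
    using Cons x by auto
  ultimately show ?case
    using lin_span_ConsI[OF assms(3)[OF x(2)]] by metis
qed (use assms(2) in simp)

end

context subring_extension
begin

lemma B_carrier: "B \<subseteq> carrier S"
  by auto

lemma span_B_zero: "set gs \<subseteq> carrier S \<Longrightarrow> \<zero> \<in> lin_span B gs"
  by (intro zero_lin_span) auto

lemma span_B_add:
  "set gs \<subseteq> carrier S \<Longrightarrow> x \<in> lin_span B gs \<Longrightarrow> y \<in> lin_span B gs \<Longrightarrow> x \<oplus> y \<in> lin_span B gs"
  by (rule lin_span_add[OF B_carrier]) auto

lemma span_B_smult:
  "set gs \<subseteq> carrier S \<Longrightarrow> b \<in> B \<Longrightarrow> x \<in> lin_span B gs \<Longrightarrow> b \<otimes> x \<in> lin_span B gs"
  by (rule lin_span_smult[OF B_carrier]) auto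

lemma span_B_base:
  assumes "set gs \<subseteq> carrier S" "g \<in> set gs"
  shows "g \<in> lin_span B gs"
  using lin_span_base[OF B_carrier _ assms(1), of \<one> g] assms by auto

text \<open>Bilinearity: \<open>lin_span_least\<close> extends the hypothesis on generators first in
  the second factor, then in the first.\<close>

lemma span_B_mult:
  assumes gs: "set gs \<subseteq> carrier S" and hs: "set hs \<subseteq> carrier S" and ks: "set ks \<subseteq> carrier S"
    and prod: "\<And>g h. g \<in> set gs \<Longrightarrow> h \<in> set hs \<Longrightarrow> g \<otimes> h \<in> lin_span B ks"
    and x: "x \<in> lin_span B gs" and y: "y \<in> lin_span B hs"
  shows "x \<otimes> y \<in> lin_span B ks"
proof -
  have "lin_span B hs \<subseteq> {y \<in> carrier S. g \<otimes> y \<in> lin_span B ks}" if g: "g \<in> set gs" for g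
  proof (rule lin_span_least)
    have gc: "g \<in> carrier S"
      using g gs by auto
    then show "\<zero> \<in> {y \<in> carrier S. g \<otimes> y \<in> lin_span B ks}"
      using span_B_zero[OF ks] by simp
    show "u \<oplus> v \<in> {y \<in> carrier S. g \<otimes> y \<in> lin_span B ks}"
      if "u \<in> {y \<in> carrier S. g \<otimes> y \<in> lin_span B ks}" "v \<in> {y \<in> carrier S. g \<otimes> y \<in> lin_span B ks}" for u v
      using that gc span_B_add[OF ks] by (simp add: r_distr)
    show "b \<otimes> h \<in> {y \<in> carrier S. g \<otimes> y \<in> lin_span B ks}" if bh: "b \<in> B" "h \<in> set hs" for b h
    proof -
      have "h \<in> carrier S"
        using bh hs by auto
      moreover have "g \<otimes> (b \<otimes> h) = b \<otimes> (g \<otimes> h)"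
        using gc calculation bh by (simp add: m_lcomm)
      ultimately show ?thesis
        using span_B_smult[OF ks bh(1) prod[OF g bh(2)]] bh by simp
    qed
  qed
  then have gy: "g \<otimes> y \<in> lin_span B ks" if "g \<in> set gs" for g
    using that y by blast
  have yc: "y \<in> carrier S"
    using y lin_span_carrier[OF B_carrier hs] by blast
  have "lin_span B gs \<subseteq> {x \<in> carrier S. x \<otimes> y \<in> lin_span B ks}"
  proof (rule lin_span_least)
    show "\<zero> \<in> {x \<in> carrier S. x \<otimes> y \<in> lin_span B ks}"
      using yc span_B_zero[OF ks] by simp
    show "u \<oplus> v \<in> {x \<in> carrier S. x \<otimes> y \<in> lin_span B ks}"
      if "u \<in> {x \<in> carrier S. x \<otimes> y \<in> lin_span B ks}" "v \<in> {x \<in> carrier S. x \<otimes> y \<in> lin_span B ks}" for u v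
      using that yc span_B_add[OF ks] by (simp add: l_distr)
    show "b \<otimes> g \<in> {x \<in> carrier S. x \<otimes> y \<in> lin_span B ks}" if bg: "b \<in> B" "g \<in> set gs" for b g
    proof -
      have "g \<in> carrier S"
        using bg gs by auto
      moreover have "b \<otimes> g \<otimes> y = b \<otimes> (g \<otimes> y)"
        using yc calculation bg by (simp add: m_assoc)
      ultimately show ?thesis
        using span_B_smult[OF ks bg(1) gy[OF bg(2)]] bg by simp
    qed
  qed
  then show ?thesis
    using x by blast
qed

text \<open>Nakayama's lemma for T modulo B: if T is finitely generated over B and contained in B +
  I T, then some v in 1 + I multiplies T into B.\<close>

lemma nakayama:
  assumes I: "ideal I ring_B" and T: "T \<subseteq> carrier S" and gs: "set gs \<subseteq> T" "T \<subseteq> lin_span B gs"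
    and eq: "\<And>x. x \<in> T \<Longrightarrow> \<exists>u\<in>B. \<exists>ts. set ts \<subseteq> T \<and> (\<exists>y\<in>lin_span I ts. x = u \<oplus> y)"
  obtains v where "v \<in> B" "\<one> \<ominus> v \<in> I" "\<And>x. x \<in> T \<Longrightarrow> v \<otimes> x \<in> B"
proof -
  interpret I: ideal I ring_B by fact
  have IB [simp]: "i \<in> B" if "i \<in> I" for i
    using I.Icarr that by auto
  have Ic: "I \<subseteq> carrier S"
    by auto
  have I_mult [simp]: "w \<otimes> m \<in> I" if "m \<in> I" "w \<in> B" for m w
    using I.I_l_closed[of m w] that by simp
  have I_add [simp]: "m \<oplus> n \<in> I" if "m \<in> I" "n \<in> I" for m n
    using I.add_mem[of m n] that by simp
  have I_zero [simp]: "\<zero> \<in> I"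
    using I.zero_mem by simp
  \<comment> \<open>Every element of T is a B-combination of \<open>gs\<close>, and I absorbs the
    coefficients; so the varying lists \<open>ts\<close> can be replaced by the fixed list
    \<open>gs\<close>.\<close>
  have I_span: "lin_span I ts \<subseteq> lin_span I gs" if ts: "set ts \<subseteq> T" for ts
  proof (rule lin_span_least)
    have gc: "set gs \<subseteq> carrier S"
      using gs T by auto
    show "\<zero> \<in> lin_span I gs"
      using gc by (intro zero_lin_span) auto
    show "x \<oplus> y \<in> lin_span I gs" if "x \<in> lin_span I gs" "y \<in> lin_span I gs" for x y
      by (rule lin_span_add[OF Ic _ gc that]) auto
    show "i \<otimes> t \<in> lin_span I gs" if it: "i \<in> I" "t \<in> set ts" for i t
    proof -
      have "lin_span B gs \<subseteq> {t \<in> carrier S. i \<otimes> t \<in> lin_span I gs}"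
      proof (rule lin_span_least)
        show "\<zero> \<in> {t \<in> carrier S. i \<otimes> t \<in> lin_span I gs}"
          using it \<open>\<zero> \<in> lin_span I gs\<close> by simp
        show "u \<oplus> v \<in> {t \<in> carrier S. i \<otimes> t \<in> lin_span I gs}"
          if uv: "u \<in> {t \<in> carrier S. i \<otimes> t \<in> lin_span I gs}" "v \<in> {t \<in> carrier S. i \<otimes> t \<in> lin_span I gs}" for u v
        proof -
          have "i \<otimes> u \<oplus> i \<otimes> v \<in> lin_span I gs"
            using uv by (intro lin_span_add[OF Ic _ gc]) auto
          then show ?thesis
            using uv it by (simp add: r_distr)
        qed
        show "b \<otimes> g \<in> {t \<in> carrier S. i \<otimes> t \<in> lin_span I gs}" if bg: "b \<in> B" "g \<in> set gs" for b g
        proof -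
          have g: "g \<in> carrier S"
            using bg gc by auto
          have "b \<otimes> i \<otimes> g \<in> lin_span I gs"
            using it bg by (intro lin_span_base[OF Ic _ gc]) auto
          moreover have "b \<otimes> i \<otimes> g = i \<otimes> (b \<otimes> g)"
            using it bg g by (simp add: m_ac)
          ultimately show ?thesis
            using bg g by simp
        qed
      qed
      then show ?thesis
        using it ts gs(2) by blast
    qed
  qed
  \<comment> \<open>Removing the generators one at a time, at the cost of a factor \<open>v \<in> 1 + I\<close>, replaces determinants.\<close>
  have elim: "\<exists>v\<in>B. \<one> \<ominus> v \<in> I \<and> (\<forall>x\<in>T. v \<otimes> x \<in> B)"
    if "v \<in> B" "\<one> \<ominus> v \<in> I" "set hs \<subseteq> T" "\<And>x. x \<in> T \<Longrightarrow> \<exists>u\<in>B. \<exists>y\<in>lin_span I hs. v \<otimes> x = u \<oplus> y"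
    for v hs
    using that
  proof (induction hs arbitrary: v)
    case Nil
    then have "v \<otimes> x \<in> B" if "x \<in> T" for x
      using Nil.prems(4)[OF that] by auto
    then show ?case
      using Nil.prems by blast
  next
    case (Cons g hs)
    have g: "g \<in> T" "g \<in> carrier S"
      using Cons.prems T by auto
    have hc: "set hs \<subseteq> carrier S"
      using Cons.prems T by auto
    have sc: "y \<in> carrier S" if "y \<in> lin_span I hs" for y
      using lin_span_carrier[OF Ic hc] that by blast
    obtain u i y where y: "u \<in> B" "i \<in> I" "y \<in> lin_span I hs" "v \<otimes> g = u \<oplus> (i \<otimes> g \<oplus> y)"
      using Cons.prems(4)[OF g(1)] by auto
    \<comment> \<open>Moving i g to the left side in v g = u + i g + y gives (v - i) g = u + y.
      Multiplying every other relation by v' then removes g from it.\<close>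
    define v' where "v' = v \<ominus> i"
    have v': "v' \<in> B"
      using Cons.prems y v'_def by simp
    have "v' \<otimes> g = v \<otimes> g \<ominus> i \<otimes> g"
      using Cons.prems(1) y g(2) unfolding v'_def by (simp add: minus_eq l_distr l_minus)
    also have "\<dots> = u \<oplus> y"
      unfolding y(4) using y g(2) sc by (simp add: minus_eq a_ac r_neg r_neg1 r_neg2)
    finally have v'g: "v' \<otimes> g = u \<oplus> y" .
    have "\<exists>u\<in>B. \<exists>y\<in>lin_span I hs. (v' \<otimes> v) \<otimes> x = u \<oplus> y" if x: "x \<in> T" for x
    proof -
      have xc: "x \<in> carrier S"
        using x T by auto
      obtain u1 i1 y1 where y1: "u1 \<in> B" "i1 \<in> I" "y1 \<in> lin_span I hs" "v \<otimes> x = u1 \<oplus> (i1 \<otimes> g \<oplus> y1)"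
        using Cons.prems(4)[OF x] by auto
      have "(v' \<otimes> v) \<otimes> x = v' \<otimes> (v \<otimes> x)"
        using v' Cons.prems(1) xc by (simp add: m_assoc)
      also have "\<dots> = v' \<otimes> u1 \<oplus> (i1 \<otimes> (v' \<otimes> g) \<oplus> v' \<otimes> y1)"
        unfolding y1(4) using v' y1 g(2) sc by (simp add: r_distr m_ac)
      also have "\<dots> = (v' \<otimes> u1 \<oplus> i1 \<otimes> u) \<oplus> (i1 \<otimes> y \<oplus> v' \<otimes> y1)"
        unfolding v'g using v' y1 y sc by (simp add: r_distr a_ac)
      finally have "(v' \<otimes> v) \<otimes> x = (v' \<otimes> u1 \<oplus> i1 \<otimes> u) \<oplus> (i1 \<otimes> y \<oplus> v' \<otimes> y1)" .
      moreover have "i1 \<otimes> y \<in> lin_span I hs" "v' \<otimes> y1 \<in> lin_span I hs"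
        using y y1 v' by (auto intro!: lin_span_smult[OF Ic _ _ hc])
      then have "i1 \<otimes> y \<oplus> v' \<otimes> y1 \<in> lin_span I hs"
        by (intro lin_span_add[OF Ic _ hc]) auto
      moreover have "v' \<otimes> u1 \<oplus> i1 \<otimes> u \<in> B"
        using v' y1 y by simp
      ultimately show ?thesis
        by blast
    qed
    moreover have "v' \<otimes> v \<in> B"
      using v' Cons.prems by simp
    moreover have "\<one> \<ominus> v' \<otimes> v \<in> I"
    proof -
      have "\<one> \<ominus> v' \<otimes> v = (\<one> \<ominus> v) \<oplus> v \<otimes> ((\<one> \<ominus> v) \<oplus> i)"
      proof -
        have "v \<otimes> ((\<one> \<ominus> v) \<oplus> i) = v \<ominus> v' \<otimes> v"
          unfolding v'_def using Cons.prems(1) y(2) by (simp add: minus_eq l_distr r_distr l_minus r_minus minus_add m_ac a_ac)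
        then show ?thesis
          using Cons.prems(1) v' by (simp add: minus_eq a_assoc r_neg1)
      qed
      then show ?thesis
        using Cons.prems(1,2) y(2) by simp
    qed
    ultimately show ?case
      using Cons.IH[of "v' \<otimes> v"] Cons.prems(3) by auto
  qed
  have "\<one> \<ominus> \<one> \<in> I"
    by (simp add: minus_eq r_neg)
  moreover have "\<exists>u\<in>B. \<exists>y\<in>lin_span I gs. \<one> \<otimes> x = u \<oplus> y" if x: "x \<in> T" for x
    using eq[OF x] I_span T x by fastforce
  ultimately show thesis
    using elim[of \<one> gs] gs(1) that by blast
qed

end

section \<open>Extremal subalgebras from the chain condition\<close>

lemma FCP_maxchain:
  assumes "FCP B S" "\<F> \<subseteq> subalgebras B S" "\<F> \<noteq> {}"
  obtains C where "finite C" "C \<noteq> {}" "C \<subseteq> \<F>" "\<And>T. T \<in> \<F> \<Longrightarrow> \<forall>A\<in>C. A \<subseteq> T \<or> T \<subseteq> A \<Longrightarrow> T \<in> C"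
    "\<And>A A'. A \<in> C \<Longrightarrow> A' \<in> C \<Longrightarrow> A \<subseteq> A' \<or> A' \<subseteq> A"
proof -
  \<comment> \<open>A maximal chain of the family is also a chain of subalgebras, hence finite. By
    maximality it contains every member of the family comparable with all of it; in particular it is
    nonempty.\<close>
  obtain C where "subset.maxchain \<F> C"
    using subset.Hausdorff[of \<F>] by blast
  then have C: "subset.chain \<F> C" "\<not> (\<exists>D. subset.chain \<F> D \<and> C \<subset> D)"
    unfolding subset.maxchain_def by blast+
  have CX: "C \<subseteq> \<F>" and lin: "\<And>A A'. A \<in> C \<Longrightarrow> A' \<in> C \<Longrightarrow> A \<subseteq> A' \<or> A' \<subseteq> A"
    using C(1) unfolding subset_chain_def by blast+
  have ext: "T \<in> C" if "T \<in> \<F>" "\<forall>A\<in>C. A \<subseteq> T \<or> T \<subseteq> A" for T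
  proof (rule ccontr)
    assume "T \<notin> C"
    moreover have "subset.chain \<F> (insert T C)"
      using that C(1) unfolding subset_chain_def by blast
    ultimately show False
      using C(2) by blast
  qed
  have "subset.chain (subalgebras B S) C"
    using C(1) assms(2) unfolding subset_chain_def by blast
  then have "finite C"
    using assms(1) unfolding FCP_def by blast
  moreover have "C \<noteq> {}"
    using ext assms(3) by blast
  ultimately show thesis
    using that CX lin ext by blast
qed

text \<open>A minimal member T of a finite maximal chain is minimal in the whole family: anything
  below T is comparable with the entire chain and hence belongs to it.\<close>

lemma FCP_minimal:
  assumes "FCP B S" "\<F> \<subseteq> subalgebras B S" "\<F> \<noteq> {}"
  obtains T where "T \<in> \<F>" "\<And>T'. T' \<in> \<F> \<Longrightarrow> T' \<subseteq> T \<Longrightarrow> T' = T"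
proof (rule FCP_maxchain[OF assms])
  fix C assume C: "finite C" "C \<noteq> {}" "C \<subseteq> \<F>"
    and ext: "\<And>T. T \<in> \<F> \<Longrightarrow> \<forall>A\<in>C. A \<subseteq> T \<or> T \<subseteq> A \<Longrightarrow> T \<in> C"
    and lin: "\<And>A A'. A \<in> C \<Longrightarrow> A' \<in> C \<Longrightarrow> A \<subseteq> A' \<or> A' \<subseteq> A"
  obtain T where T: "T \<in> C" "\<forall>A\<in>C. A \<subseteq> T \<longrightarrow> T = A"
    using finite_has_minimal[OF C(1,2)] by blast
  have "T' = T" if T': "T' \<in> \<F>" "T' \<subseteq> T" for T'
  proof -
    have "A \<subseteq> T' \<or> T' \<subseteq> A" if A: "A \<in> C" for A
      using lin[OF T(1) A] bspec[OF T(2) A] T' by auto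
    then show ?thesis
      using ext[OF T'(1)] T(2) T'(2) by auto
  qed
  then show thesis
    using that T(1) C(3) by blast
qed

lemma FCP_maximal:
  assumes "FCP B S" "\<F> \<subseteq> subalgebras B S" "\<F> \<noteq> {}"
  obtains T where "T \<in> \<F>" "\<And>T'. T' \<in> \<F> \<Longrightarrow> T \<subseteq> T' \<Longrightarrow> T' = T"
proof (rule FCP_maxchain[OF assms])
  fix C assume C: "finite C" "C \<noteq> {}" "C \<subseteq> \<F>"
    and ext: "\<And>T. T \<in> \<F> \<Longrightarrow> \<forall>A\<in>C. A \<subseteq> T \<or> T \<subseteq> A \<Longrightarrow> T \<in> C"
    and lin: "\<And>A A'. A \<in> C \<Longrightarrow> A' \<in> C \<Longrightarrow> A \<subseteq> A' \<or> A' \<subseteq> A"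
  obtain T where T: "T \<in> C" "\<forall>A\<in>C. T \<subseteq> A \<longrightarrow> T = A"
    using finite_has_maximal[OF C(1,2)] by blast
  have "T' = T" if T': "T' \<in> \<F>" "T \<subseteq> T'" for T'
  proof -
    have "A \<subseteq> T' \<or> T' \<subseteq> A" if A: "A \<in> C" for A
      using lin[OF T(1) A] bspec[OF T(2) A] T' by auto
    then show ?thesis
      using ext[OF T'(1)] T(2) T'(2) by auto
  qed
  then show thesis
    using that T(1) C(3) by blast
qed

section \<open>Module-finiteness of subalgebras\<close>

context subring_extension
begin

lemma powers_in_span:
  assumes t: "t \<in> carrier S" and p: "set p \<subseteq> B" "eval (\<one> # p) t = \<zero>"
  shows "t [^] (k::nat) \<in> lin_span B (map (\<lambda>i. t [^] i) [0..<Suc (length p)])"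
proof -
  define n where "n = length p"
  \<comment> \<open>With n the degree of the equation, the list runs from t^0 to t^n inclusive:
    multiplying a tail of the equation by t can produce the exponent n.\<close>
  define pw where "pw = map (\<lambda>i::nat. t [^] i) [0..<Suc n]"
  have pc: "set pw \<subseteq> carrier S"
    using t pw_def by auto
  have set_pw: "set pw = (\<lambda>i. t [^] i) ` {..n}"
    unfolding pw_def by (simp add: atLeast0LessThan lessThan_Suc_atMost del: upt_Suc)
  have low: "t [^] i \<in> lin_span B pw" if "i \<le> n" for i :: nat
    using that by (intro span_B_base[OF pc]) (simp add: set_pw)
  have eval_t: "eval q t \<in> carrier S \<and> eval q t \<otimes> t \<in> lin_span B pw" if "set q \<subseteq> B" "length q \<le> n" for q
    using that
  proof (induction q)
    case Nil
    then show ?case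
      using span_B_zero[OF pc] t by simp
  next
    case (Cons c q)
    have c: "c \<in> B"
      using Cons by simp
    have "c \<otimes> t [^] Suc (length q) \<in> lin_span B pw"
      using Cons.prems by (intro span_B_smult[OF pc c] low) auto
    then have "c \<otimes> t [^] Suc (length q) \<oplus> eval q t \<otimes> t \<in> lin_span B pw"
      using Cons by (intro span_B_add[OF pc]) auto
    moreover have "eval (c # q) t \<otimes> t = c \<otimes> t [^] Suc (length q) \<oplus> eval q t \<otimes> t"
      using Cons c t by (simp add: l_distr m_assoc)
    ultimately show ?case
      using Cons c t by simp
  qed
  have ep: "eval p t \<in> carrier S" "eval p t \<otimes> t \<in> lin_span B pw"
    using eval_t[of p] p n_def by auto
  \<comment> \<open>The monic equation expresses t^n by lower powers. After multiplication by t it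
    puts t^(n+1) into the span, which is therefore stable under multiplication by t.\<close>
  have "t [^] n \<oplus> eval p t = \<zero>"
    using p(2) t ep unfolding n_def by simp
  then have "t [^] n = \<ominus> eval p t"
    using t ep by (simp add: sum_zero_eq_neg)
  then have "t [^] Suc n = (\<ominus> \<one>) \<otimes> (eval p t \<otimes> t)"
    using t ep by (simp add: l_minus)
  then have top: "t [^] Suc n \<in> lin_span B pw"
    using span_B_smult[OF pc _ ep(2), of "\<ominus> \<one>"] by simp
  have closed: "lin_span B pw \<subseteq> {x \<in> carrier S. x \<otimes> t \<in> lin_span B pw}"
  proof (rule lin_span_least)
    show "\<zero> \<in> {x \<in> carrier S. x \<otimes> t \<in> lin_span B pw}"
      using t span_B_zero[OF pc] by simp
    show "x \<oplus> y \<in> {x \<in> carrier S. x \<otimes> t \<in> lin_span B pw}"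
      if "x \<in> {x \<in> carrier S. x \<otimes> t \<in> lin_span B pw}" "y \<in> {x \<in> carrier S. x \<otimes> t \<in> lin_span B pw}" for x y
      using that t span_B_add[OF pc] by (simp add: l_distr)
    show "b \<otimes> g \<in> {x \<in> carrier S. x \<otimes> t \<in> lin_span B pw}" if b: "b \<in> B" and g: "g \<in> set pw" for b g
    proof -
      obtain i where i: "g = t [^] i" "i \<le> n"
        using g pw_def by (auto simp: less_Suc_eq_le)
      have "t [^] Suc i \<in> lin_span B pw"
        using low[of "Suc i"] top i by (cases "i = n") auto
      then have "b \<otimes> t [^] Suc i \<in> lin_span B pw"
        by (intro span_B_smult[OF pc b])
      then show ?thesis
        using b t i by (simp add: m_assoc)
    qed
  qed
  have "t [^] k \<in> lin_span B pw"
  proof (induction k)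
    case 0
    then show ?case using low[of 0] by simp
  next
    case (Suc k)
    then show ?case using closed by auto
  qed
  then show ?thesis
    unfolding pw_def n_def .
qed

lemma subalgebras_iff: "T \<in> subalgebras B S \<longleftrightarrow> subcring T S \<and> B \<subseteq> T"
  by (simp add: subalgebras_def)

text \<open>The ring A[t] is the A-span of finitely many powers of t, and products of these powers
  with generators of A generate it over B. The last conclusion, its minimality, keeps A[t] inside
  any given subring containing A and t.\<close>

lemma finite_adjoin:
  assumes A: "A \<in> subalgebras B S" "set gs \<subseteq> A" "A \<subseteq> lin_span B gs"
    and t: "t \<in> carrier S" and p: "set p \<subseteq> B" "eval (\<one> # p) t = \<zero>"
  obtains A' hs where "A' \<in> subalgebras B S" "A \<subseteq> A'" "t \<in> A'" "set hs \<subseteq> A'" "A' \<subseteq> lin_span B hs"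
    "\<forall>T. subcring T S \<longrightarrow> A \<subseteq> T \<longrightarrow> t \<in> T \<longrightarrow> A' \<subseteq> T"
proof -
  have sub: "subcring A S" "B \<subseteq> A"
    using A(1) subalgebras_iff by auto
  interpret A: subring_extension S A
    by (intro subring_extension.intro subring_extension_axioms.intro cring_axioms sub)
  define pw where "pw = map (\<lambda>i. t [^] i) [0..<Suc (length p)]"
  have pc: "set pw \<subseteq> carrier S"
    using t pw_def by auto
  have pows: "t [^] k \<in> lin_span A pw" for k :: nat
    unfolding pw_def using A.powers_in_span[OF t _ p(2)] p(1) sub(2) by auto
  have powsB: "t [^] k \<in> lin_span B pw" for k :: nat
    unfolding pw_def by (rule powers_in_span[OF t p])
  have gc: "set gs \<subseteq> carrier S"
    using A(2) A.B_carrier by auto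
  define A' where "A' = lin_span A pw"
  have pwA: "g \<in> A'" if "g \<in> set pw" for g
    unfolding A'_def by (rule A.span_B_base[OF pc that])
  have AA': "a \<in> A'" if "a \<in> A" for a
  proof -
    have "a \<otimes> t [^] (0::nat) \<in> A'"
      unfolding A'_def by (rule A.span_B_smult[OF pc that pows])
    then show ?thesis
      using that by simp
  qed
  have mult: "x \<otimes> y \<in> A'" if "x \<in> A'" "y \<in> A'" for x y
    unfolding A'_def
  proof (rule A.span_B_mult[OF pc pc pc])
    fix g h assume "g \<in> set pw" "h \<in> set pw"
    then obtain i j :: nat where "g = t [^] i" "h = t [^] j"
      unfolding pw_def by auto
    then show "g \<otimes> h \<in> lin_span A pw"
      using pows[of "i + j"] t by (simp add: nat_pow_mult)
  qed (use that A'_def in auto)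
  have "subcring A' S"
  proof (rule subcringI', rule subringI)
    show "A' \<subseteq> carrier S"
      unfolding A'_def by (rule lin_span_carrier[OF A.B_carrier pc])
    show "\<one> \<in> A'"
      using AA' by simp
    show "\<ominus> h \<in> A'" if h: "h \<in> A'" for h
    proof -
      have "(\<ominus> \<one>) \<otimes> h \<in> A'"
        using AA' h by (intro mult) auto
      then show ?thesis
        using h \<open>A' \<subseteq> carrier S\<close> by (auto simp: l_minus)
    qed
    show "h \<otimes> k \<in> A'" if "h \<in> A'" "k \<in> A'" for h k
      using that by (rule mult)
    show "h \<oplus> k \<in> A'" if "h \<in> A'" "k \<in> A'" for h k
      using that unfolding A'_def by (rule A.span_B_add[OF pc])
  qed
  then have 1: "A' \<in> subalgebras B S"
    using AA' sub(2) subalgebras_iff by auto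
  have 2: "t \<in> A'"
    using pows[of 1] t A'_def by simp
  define hs where "hs = concat (map (\<lambda>g. map (\<lambda>h. g \<otimes> h) pw) gs)"
  have set_hs: "set hs = {g \<otimes> h | g h. g \<in> set gs \<and> h \<in> set pw}"
    unfolding hs_def by auto
  have hc: "set hs \<subseteq> carrier S"
    using gc pc set_hs by auto
  have 3: "set hs \<subseteq> A'"
    using set_hs mult AA' A(2) pwA by auto
  have 4: "A' \<subseteq> lin_span B hs"
    unfolding A'_def
  proof (rule lin_span_least)
    show "\<zero> \<in> lin_span B hs"
      by (rule span_B_zero[OF hc])
    show "x \<oplus> y \<in> lin_span B hs" if "x \<in> lin_span B hs" "y \<in> lin_span B hs" for x y
      using that by (rule span_B_add[OF hc])
    show "a \<otimes> g \<in> lin_span B hs" if "a \<in> A" "g \<in> set pw" for a g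
    proof (rule span_B_mult[OF gc pc hc])
      show "g \<otimes> h \<in> lin_span B hs" if "g \<in> set gs" "h \<in> set pw" for g h
        using that set_hs by (intro span_B_base[OF hc]) auto
      show "a \<in> lin_span B gs"
        using that A(3) by blast
      show "g \<in> lin_span B pw"
        using that powsB unfolding pw_def by auto
    qed
  qed
  have 5: "A' \<subseteq> T" if T: "subcring T S" "A \<subseteq> T" "t \<in> T" for T
  proof -
    interpret T: subring_extension S T
      by (intro subring_extension.intro subring_extension_axioms.intro cring_axioms T)
    show ?thesis
      unfolding A'_def
    proof (rule lin_span_least)
      show "a \<otimes> g \<in> T" if "a \<in> A" "g \<in> set pw" for a g
        using that T(2,3) unfolding pw_def by auto
    qed auto
  qed
  show thesis
    using that[OF 1 _ 2 3 4] AA' 5 by blast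
qed

text \<open>Among the finitely generated subalgebras inside T choose a maximal one. Adjoining any t
  in T keeps it finitely generated by integrality, so it already contains t.\<close>

lemma FCP_finite:
  assumes int: "integral" and fcp: "FCP B S" and T: "T \<in> subalgebras B S"
  obtains gs where "set gs \<subseteq> T" "T \<subseteq> lin_span B gs"
proof -
  define F where "F = {A \<in> subalgebras B S. A \<subseteq> T \<and> (\<exists>gs. set gs \<subseteq> A \<and> A \<subseteq> lin_span B gs)}"
  have "b \<in> lin_span B [\<one>]" if "b \<in> B" for b
    using lin_span_base[OF B_carrier, of "[\<one>]" b \<one>] that by simp
  then have "B \<subseteq> lin_span B [\<one>]"
    by blast
  moreover have "set [\<one>] \<subseteq> B"
    by simp
  ultimately have "B \<in> F"
    using T subcring unfolding F_def subalgebras_iff by blast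
  moreover have "F \<subseteq> subalgebras B S"
    unfolding F_def by blast
  ultimately obtain A where A: "A \<in> F" and max: "\<And>A'. A' \<in> F \<Longrightarrow> A \<subseteq> A' \<Longrightarrow> A' = A"
    using FCP_maximal[OF fcp, of F] by auto
  obtain gs where gs: "A \<in> subalgebras B S" "A \<subseteq> T" "set gs \<subseteq> A" "A \<subseteq> lin_span B gs"
    using A F_def by blast
  have "t \<in> A" if t: "t \<in> T" for t
  proof -
    have tc: "t \<in> carrier S"
      using t T subalgebras_iff subcringE(1) by blast
    then obtain p where p: "set p \<subseteq> B" "eval (\<one> # p) t = \<zero>"
      using int unfolding integral_def by blast
    obtain A' hs where A': "A' \<in> subalgebras B S" "A \<subseteq> A'" "t \<in> A'" "set hs \<subseteq> A'" "A' \<subseteq> lin_span B hs"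
      "\<forall>T. subcring T S \<longrightarrow> A \<subseteq> T \<longrightarrow> t \<in> T \<longrightarrow> A' \<subseteq> T"
      by (rule finite_adjoin[OF gs(1,3,4) tc p])
    have "A' \<subseteq> T"
      using A'(6) T gs(2) t subalgebras_iff by blast
    then have "A' \<in> F"
      unfolding F_def using A'(1,4,5) by blast
    then show ?thesis
      using max A'(2,3) by blast
  qed
  then show thesis
    using that[of gs] gs by blast
qed

lemma sum_subalgebra:
  assumes J: "J \<subseteq> carrier S" "\<zero> \<in> J" "\<And>x y. x \<in> J \<Longrightarrow> y \<in> J \<Longrightarrow> x \<oplus> y \<in> J"
    "\<And>b x. b \<in> B \<Longrightarrow> x \<in> J \<Longrightarrow> b \<otimes> x \<in> J" "\<And>x y. x \<in> J \<Longrightarrow> y \<in> J \<Longrightarrow> x \<otimes> y \<in> J"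
  shows "{b \<oplus> x | b x. b \<in> B \<and> x \<in> J} \<in> subalgebras B S"
proof -
  let ?T = "{b \<oplus> x | b x. b \<in> B \<and> x \<in> J}"
  have Jc [simp]: "x \<in> carrier S" if "x \<in> J" for x
    using J(1) that by blast
  have TI: "b \<oplus> x \<in> ?T" if "b \<in> B" "x \<in> J" for b x
    using that by blast
  have BT: "b \<in> ?T" if "b \<in> B" for b
    using TI[OF that J(2)] that by simp
  have "subcring ?T S"
  proof (rule subcringI', rule subringI)
    show "?T \<subseteq> carrier S"
      by auto
    show "\<one> \<in> ?T"
      by (rule BT) simp
    fix h assume "h \<in> ?T"
    then obtain b x where h: "h = b \<oplus> x" "b \<in> B" "x \<in> J"
      by blast
    have "\<ominus> h = \<ominus> b \<oplus> (\<ominus> \<one>) \<otimes> x"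
      using h by (simp add: minus_add l_minus)
    then show "\<ominus> h \<in> ?T"
      using TI[of "\<ominus> b" "(\<ominus> \<one>) \<otimes> x"] J(4)[of "\<ominus> \<one>" x] h by simp
    fix k assume "k \<in> ?T"
    then obtain b' x' where k: "k = b' \<oplus> x'" "b' \<in> B" "x' \<in> J"
      by blast
    have "h \<oplus> k = (b \<oplus> b') \<oplus> (x \<oplus> x')"
      using h k by (simp add: a_ac)
    then show "h \<oplus> k \<in> ?T"
      using TI[of "b \<oplus> b'" "x \<oplus> x'"] J(3) h k by simp
    have "h \<otimes> k = (b \<otimes> b') \<oplus> ((b \<otimes> x' \<oplus> b' \<otimes> x) \<oplus> x \<otimes> x')"
      using h k by (simp add: l_distr r_distr m_ac a_ac)
    moreover have "(b \<otimes> x' \<oplus> b' \<otimes> x) \<oplus> x \<otimes> x' \<in> J"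
      using h k by (intro J(3) J(4) J(5))
    ultimately show "h \<otimes> k \<in> ?T"
      using TI[of "b \<otimes> b'"] h k by simp
  qed
  then show ?thesis
    using BT subalgebras_iff by blast
qed

end

section \<open>The conductor and separating idempotents\<close>

context subring_extension
begin

definition conductor where
  "conductor = {c \<in> B. \<forall>s\<in>carrier S. c \<otimes> s \<in> B}"

lemma scaled_subalgebra:
  assumes "u \<in> B" "T \<in> subalgebras B S"
  shows "{b \<oplus> x | b x. b \<in> B \<and> x \<in> (\<lambda>t. u \<otimes> t) ` T} \<in> subalgebras B S"
proof (rule sum_subalgebra)
  have T: "subcring T S" "B \<subseteq> T"
    using assms(2) subalgebras_iff by auto
  interpret T: subring_extension S T
    by (intro subring_extension.intro subring_extension_axioms.intro cring_axioms T)
  have u: "u \<in> carrier S"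
    using assms by auto
  show "(\<lambda>t. u \<otimes> t) ` T \<subseteq> carrier S"
    using u by auto
  have "\<zero> = u \<otimes> \<zero>"
    using u by simp
  then show "\<zero> \<in> (\<lambda>t. u \<otimes> t) ` T"
    using T.sub_closed(1) by blast
  show "x \<oplus> y \<in> (\<lambda>t. u \<otimes> t) ` T" if xy: "x \<in> (\<lambda>t. u \<otimes> t) ` T" "y \<in> (\<lambda>t. u \<otimes> t) ` T" for x y
  proof -
    obtain t s where "x = u \<otimes> t" "t \<in> T" "y = u \<otimes> s" "s \<in> T"
      using xy by blast
    then show ?thesis
      using u by (intro image_eqI[of _ _ "t \<oplus> s"]) (auto simp: r_distr)
  qed
  show "b \<otimes> x \<in> (\<lambda>t. u \<otimes> t) ` T" if bx: "b \<in> B" "x \<in> (\<lambda>t. u \<otimes> t) ` T" for b x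
  proof -
    obtain t where "x = u \<otimes> t" "t \<in> T"
      using bx by blast
    then show ?thesis
      using u bx T(2) by (intro image_eqI[of _ _ "b \<otimes> t"]) (auto simp: m_lcomm)
  qed
  show "x \<otimes> y \<in> (\<lambda>t. u \<otimes> t) ` T" if xy: "x \<in> (\<lambda>t. u \<otimes> t) ` T" "y \<in> (\<lambda>t. u \<otimes> t) ` T" for x y
  proof -
    obtain t s where "x = u \<otimes> t" "t \<in> T" "y = u \<otimes> s" "s \<in> T"
      using xy by blast
    then show ?thesis
      using u assms(1) T(2) by (intro image_eqI[of _ _ "u \<otimes> t \<otimes> s"]) (auto simp: m_ac)
  qed
qed

lemma carrier_subalgebra: "carrier S \<in> subalgebras B S"
  using carrier_is_subcring subalgebras_iff by auto

text \<open>The subalgebras B + u^n S decrease, so the chain condition gives equality for some n and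
  n + 1. Nakayama's lemma with the ideal uB yields v in 1 + uB with v u^n in the conductor, hence in
  P. As u is outside P, v lies in P, and u is invertible modulo P.\<close>

lemma maximal_if_conductor_subset:
  assumes int: "integral" and fcp: "FCP B S" and P: "primeideal P ring_B" "conductor \<subseteq> P"
    and u: "u \<in> B" "u \<notin> P"
  obtains w where "w \<in> B" "\<one> \<ominus> u \<otimes> w \<in> P"
proof -
  interpret P: primeideal P ring_B by (rule P(1))
  define T where "T n = {b \<oplus> x | b x. b \<in> B \<and> x \<in> (\<lambda>t. u [^] (n::nat) \<otimes> t) ` carrier S}" for n
  have TI: "b \<oplus> u [^] n \<otimes> s \<in> T n" if "b \<in> B" "s \<in> carrier S" for b s n
    using that T_def by blast
  have TE: "\<exists>b\<in>B. \<exists>s\<in>carrier S. x = b \<oplus> u [^] n \<otimes> s" if "x \<in> T n" for x n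
    using that T_def by blast
  have uc: "u \<in> carrier S"
    using u by auto
  have T: "T n \<in> subalgebras B S" for n
    unfolding T_def using u by (intro scaled_subalgebra carrier_subalgebra) auto
  have "range T \<subseteq> subalgebras B S" "range T \<noteq> {}"
    using T by auto
  then obtain T0 where T0: "T0 \<in> range T" and min: "\<And>T'. T' \<in> range T \<Longrightarrow> T' \<subseteq> T0 \<Longrightarrow> T' = T0"
    using FCP_minimal[OF fcp] by metis
  obtain n where n: "T0 = T n"
    using T0 by blast
  have "T (Suc n) \<subseteq> T n"
  proof
    fix x assume "x \<in> T (Suc n)"
    then obtain b s where bs: "b \<in> B" "s \<in> carrier S" "x = b \<oplus> u [^] Suc n \<otimes> s"
      using TE by blast
    then have "x = b \<oplus> u [^] n \<otimes> (u \<otimes> s)"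
      using uc by (simp add: m_assoc)
    then show "x \<in> T n"
      using TI[OF bs(1), of "u \<otimes> s" n] bs(2) uc by simp
  qed
  then have eq: "T (Suc n) = T n"
    using min n by blast
  define I where "I = (\<lambda>w. u \<otimes> w) ` B"
  have I: "ideal I ring_B"
  proof (rule ideal_subI)
    show "I \<subseteq> B"
      using u I_def by auto
    have "\<zero> = u \<otimes> \<zero>"
      using uc by simp
    then show "\<zero> \<in> I"
      unfolding I_def using sub_closed(1) by blast
    show "x \<oplus> y \<in> I" if xy: "x \<in> I" "y \<in> I" for x y
    proof -
      obtain t s where "x = u \<otimes> t" "t \<in> B" "y = u \<otimes> s" "s \<in> B"
        using xy unfolding I_def by blast
      then show ?thesis
        unfolding I_def using uc by (intro image_eqI[of _ _ "t \<oplus> s"]) (auto simp: r_distr)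
    qed
    show "b \<otimes> x \<in> I" if bx: "x \<in> I" "b \<in> B" for x b
    proof -
      obtain t where "x = u \<otimes> t" "t \<in> B"
        using bx unfolding I_def by blast
      then show ?thesis
        unfolding I_def using uc bx by (intro image_eqI[of _ _ "b \<otimes> t"]) (auto simp: m_lcomm)
    qed
  qed
  obtain gs where gs: "set gs \<subseteq> T n" "T n \<subseteq> lin_span B gs"
    using FCP_finite[OF int fcp T] by blast
  have Tc: "T n \<subseteq> carrier S"
    using T subalgebras_iff subcringE(1) by blast
  have uI: "u \<in> I"
    unfolding I_def using uc by (intro image_eqI[of _ _ \<one>]) auto
  have "\<exists>w\<in>B. \<exists>ts. set ts \<subseteq> T n \<and> (\<exists>y\<in>lin_span I ts. x = w \<oplus> y)" if x: "x \<in> T n" for x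
  proof -
    obtain b s where bs: "b \<in> B" "s \<in> carrier S" "x = b \<oplus> u [^] Suc n \<otimes> s"
      using TE[of x "Suc n"] x eq by blast
    \<comment> \<open>Stability rewrites x with u^(n+1) s = u (u^n s), a product of an element of I
      and one of T n.\<close>
    let ?t = "u [^] n \<otimes> s"
    have "?t \<in> T n"
      using TI[of \<zero> s n] bs uc by simp
    moreover have "u \<otimes> ?t \<oplus> \<zero> \<in> lin_span I [?t]"
      using uI by (intro lin_span_ConsI) auto
    moreover have "x = b \<oplus> (u \<otimes> ?t \<oplus> \<zero>)"
      using bs uc by (simp add: m_ac)
    ultimately show ?thesis
      using bs(1) by (intro bexI[of _ b] exI[of _ "[?t]"] conjI bexI[of _ "u \<otimes> ?t \<oplus> \<zero>"]) auto
  qed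
  then obtain v where v: "v \<in> B" "\<one> \<ominus> v \<in> I" "\<And>x. x \<in> T n \<Longrightarrow> v \<otimes> x \<in> B"
    using nakayama[OF I Tc gs] by metis
  have "v \<otimes> u [^] n \<otimes> s \<in> B" if "s \<in> carrier S" for s
    using v(3)[of "u [^] n \<otimes> s"] TI[of \<zero> s n] that v(1) uc by (simp add: m_assoc)
  then have "v \<otimes> u [^] n \<in> conductor"
    unfolding conductor_def using v(1) u(1) by simp
  then have "v \<otimes> u [^] n \<in> P"
    using P(2) by blast
  moreover have "u [^] n \<notin> P"
    using P.mem_if_pow_mem[of u n] u nat_pow_consistent[of u n B] by auto
  ultimately have "v \<in> P"
    using P.I_prime[of v "u [^] n"] v(1) u(1) by auto
  moreover obtain w where w: "w \<in> B" "\<one> \<ominus> v = u \<otimes> w"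
    using v(2) I_def by blast
  then have "\<one> \<ominus> u \<otimes> w = v"
    unfolding w(2)[symmetric] using sub_carrier[OF v(1)] by algebra
  ultimately show thesis
    using that w(1) by simp
qed

text \<open>This is the product P T; for T the whole carrier it is the extended ideal P S. The list
  of elements of T may vary, so sums are formed by concatenation.\<close>

definition extended where
  "extended P T = {x. \<exists>ts. set ts \<subseteq> T \<and> x \<in> lin_span P ts}"

lemma extended_add:
  assumes P: "P \<subseteq> carrier S" "\<zero> \<in> P" and T: "T \<subseteq> carrier S"
    and "x \<in> extended P T" "y \<in> extended P T"
  shows "x \<oplus> y \<in> extended P T"
proof -
  obtain ts ss where ts: "set ts \<subseteq> T" "x \<in> lin_span P ts" and ss: "set ss \<subseteq> T" "y \<in> lin_span P ss"
    using assms(4,5) unfolding extended_def by blast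
  have "x \<oplus> y \<in> lin_span P (ts @ ss)"
    using ts
  proof (induction ts arbitrary: x)
    case Nil
    then show ?case
      using ss lin_span_carrier[OF P(1), of ss] T by (auto simp: subset_iff)
  next
    case (Cons t ts)
    obtain k x' where x: "x = k \<otimes> t \<oplus> x'" "k \<in> P" "x' \<in> lin_span P ts"
      using Cons.prems(2) by auto
    have "k \<in> carrier S" "t \<in> carrier S" "x' \<in> carrier S" "y \<in> carrier S"
      using x ss P(1) T Cons.prems(1) lin_span_carrier[OF P(1), of ts] lin_span_carrier[OF P(1), of ss]
      by (auto simp: subset_iff)
    then have "x \<oplus> y = k \<otimes> t \<oplus> (x' \<oplus> y)"
      using x(1) by (simp add: a_assoc)
    moreover have "x' \<oplus> y \<in> lin_span P (ts @ ss)"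
      using Cons x by auto
    ultimately show ?case
      using lin_span_ConsI[OF x(2)] by simp
  qed
  then show ?thesis
    unfolding extended_def using ts ss by (intro CollectI exI[of _ "ts @ ss"]) auto
qed

lemma extended_zero: "\<zero> \<in> extended P T"
  unfolding extended_def by (intro CollectI exI[of _ "[]"]) auto

lemma extended_base:
  assumes "P \<subseteq> carrier S" "T \<subseteq> carrier S" "p \<in> P" "t \<in> T"
  shows "p \<otimes> t \<in> extended P T"
proof -
  have "p \<otimes> t \<oplus> \<zero> \<in> lin_span P [t]"
    using assms(3) by (intro lin_span_ConsI) auto
  moreover have "p \<otimes> t \<oplus> \<zero> = p \<otimes> t"
    using assms by (intro r_zero) auto
  ultimately show ?thesis
    unfolding extended_def using assms(4) by (intro CollectI exI[of _ "[t]"]) auto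
qed

lemma extended_least:
  assumes "x \<in> extended P T" "\<zero> \<in> Y" "\<And>x y. x \<in> Y \<Longrightarrow> y \<in> Y \<Longrightarrow> x \<oplus> y \<in> Y"
    and "\<And>p t. p \<in> P \<Longrightarrow> t \<in> T \<Longrightarrow> p \<otimes> t \<in> Y"
  shows "x \<in> Y"
proof -
  obtain ts where ts: "set ts \<subseteq> T" "x \<in> lin_span P ts"
    using assms(1) unfolding extended_def by blast
  have "lin_span P ts \<subseteq> Y"
    using assms(2,3) by (rule lin_span_least) (use assms(4) ts(1) in auto)
  then show ?thesis
    using ts by blast
qed

lemma extended_carrier:
  assumes "P \<subseteq> carrier S" "T \<subseteq> carrier S"
  shows "extended P T \<subseteq> carrier S"
proof
  fix x assume "x \<in> extended P T"
  then show "x \<in> carrier S"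
    by (rule extended_least) (use assms in auto)
qed

text \<open>Source T and target T' are kept separate, since multiplication by s may carry all of S
  into a smaller subalgebra and thereby P S into P T'.\<close>

lemma extended_mult:
  assumes P: "P \<subseteq> carrier S" "\<zero> \<in> P" and T: "T \<subseteq> carrier S" "T' \<subseteq> carrier S"
    and s: "s \<in> carrier S" "\<And>t. t \<in> T \<Longrightarrow> s \<otimes> t \<in> T'" and x: "x \<in> extended P T"
  shows "s \<otimes> x \<in> extended P T'"
proof -
  have "x \<in> {x \<in> carrier S. s \<otimes> x \<in> extended P T'}"
    using x
  proof (rule extended_least)
    show "\<zero> \<in> {x \<in> carrier S. s \<otimes> x \<in> extended P T'}"
      using extended_zero s by simp
    show "x \<oplus> y \<in> {x \<in> carrier S. s \<otimes> x \<in> extended P T'}"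
      if "x \<in> {x \<in> carrier S. s \<otimes> x \<in> extended P T'}" "y \<in> {x \<in> carrier S. s \<otimes> x \<in> extended P T'}" for x y
      using that s extended_add[OF P T(2)] by (simp add: r_distr)
    show "p \<otimes> t \<in> {x \<in> carrier S. s \<otimes> x \<in> extended P T'}" if pt: "p \<in> P" "t \<in> T" for p t
    proof -
      have "p \<in> carrier S" "t \<in> carrier S"
        using pt P T by auto
      moreover have "p \<otimes> (s \<otimes> t) \<in> extended P T'"
        using pt s by (intro extended_base P T) auto
      ultimately show ?thesis
        using s by (simp add: m_lcomm)
    qed
  qed
  then show ?thesis
    by blast
qed

text \<open>Choose T minimal among the subalgebras that contain all u w^r s for some u outside P and
  some r, uniformly in w from P S and s from S. Minimality gives T = B + P T; Nakayama's lemma then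
  gives v in 1 + P with v T inside B, and minimality once more gives T = B + v T, so T is B.\<close>

lemma power_in_conductor_locally:
  assumes int: "integral" and fcp: "FCP B S" and P: "primeideal P ring_B"
  obtains u r where "u \<in> B" "u \<notin> P"
    "\<And>w s. w \<in> extended P (carrier S) \<Longrightarrow> s \<in> carrier S \<Longrightarrow> u \<otimes> w [^] (r::nat) \<otimes> s \<in> B"
proof -
  interpret P: primeideal P ring_B by (rule P)
  have PB: "p \<in> B" if "p \<in> P" for p
    using P.Icarr that by auto
  have Pc: "P \<subseteq> carrier S" and P0: "\<zero> \<in> P"
    using PB P.zero_mem by auto
  define J where "J = extended P (carrier S)"
  have Jc: "J \<subseteq> carrier S"
    unfolding J_def by (intro extended_carrier Pc) auto
  define F where "F = {T \<in> subalgebras B S. \<exists>u\<in>B - P. \<exists>r::nat. \<forall>w\<in>J. \<forall>s\<in>carrier S. u \<otimes> w [^] r \<otimes> s \<in> T}"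
  have FI: "T \<in> F" if "T \<in> subalgebras B S" "u \<in> B" "u \<notin> P"
    "\<And>w s. w \<in> J \<Longrightarrow> s \<in> carrier S \<Longrightarrow> u \<otimes> w [^] r \<otimes> s \<in> T" for T u and r :: nat
    unfolding F_def using that by blast
  have "carrier S \<in> F"
  proof (rule FI[OF carrier_subalgebra sub_closed(2)])
    show "\<one> \<notin> P"
      using P.one_notin by simp
    show "\<one> \<otimes> w [^] (0::nat) \<otimes> s \<in> carrier S" if "s \<in> carrier S" for w s
      using that by simp
  qed
  moreover have "F \<subseteq> subalgebras B S"
    unfolding F_def by blast
  ultimately obtain T where T: "T \<in> F" and min: "\<And>T'. T' \<in> F \<Longrightarrow> T' \<subseteq> T \<Longrightarrow> T' = T"
    using FCP_minimal[OF fcp, of F] by (metis empty_iff)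
  obtain u r where Ts: "T \<in> subalgebras B S" and u: "u \<in> B" "u \<notin> P"
    and ur: "\<And>w s. w \<in> J \<Longrightarrow> s \<in> carrier S \<Longrightarrow> u \<otimes> w [^] (r::nat) \<otimes> s \<in> T"
    using T unfolding F_def by blast
  have sub: "subcring T S" "B \<subseteq> T"
    using Ts subalgebras_iff by auto
  interpret T: subring_extension S T
    by (intro subring_extension.intro subring_extension_axioms.intro cring_axioms sub)
  have ePT: "x \<in> T" if "x \<in> extended P T" for x
    using that by (rule extended_least) (use PB sub in auto)
  \<comment> \<open>B + P T satisfies the condition with exponent r + 1: multiplication by u w^r s
    maps S into T, hence maps the additional factor w of P S into P T.\<close>
  have T1: "{b \<oplus> x | b x. b \<in> B \<and> x \<in> extended P T} = T"
  proof (rule min)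
    show "{b \<oplus> x | b x. b \<in> B \<and> x \<in> extended P T} \<in> F"
    proof (rule FI[OF _ u])
      show "{b \<oplus> x | b x. b \<in> B \<and> x \<in> extended P T} \<in> subalgebras B S"
      proof (rule sum_subalgebra)
        show "extended P T \<subseteq> carrier S"
          by (rule extended_carrier[OF Pc T.B_carrier])
        show "x \<oplus> y \<in> extended P T" if "x \<in> extended P T" "y \<in> extended P T" for x y
          using that by (rule extended_add[OF Pc P0 T.B_carrier])
        show "b \<otimes> x \<in> extended P T" if "b \<in> B" "x \<in> extended P T" for b x
          by (rule extended_mult[OF Pc P0 T.B_carrier T.B_carrier _ _ that(2)]) (use that sub in auto)
        show "x \<otimes> y \<in> extended P T" if "x \<in> extended P T" "y \<in> extended P T" for x y
          by (rule extended_mult[OF Pc P0 T.B_carrier T.B_carrier _ _ that(2)]) (use that ePT in auto)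
      qed (rule extended_zero)
      fix w s assume ws: "w \<in> J" "s \<in> carrier S"
      have wc: "w \<in> carrier S" and uc: "u \<in> carrier S"
        using ws Jc u by auto
      have "(u \<otimes> w [^] r \<otimes> s) \<otimes> w \<in> extended P T"
      proof (rule extended_mult[OF Pc P0 subset_refl T.B_carrier])
        show "u \<otimes> w [^] r \<otimes> s \<in> carrier S"
          using ws wc uc by simp
        show "u \<otimes> w [^] r \<otimes> s \<otimes> t \<in> T" if "t \<in> carrier S" for t
          using ur[of w "s \<otimes> t"] ws wc uc that by (simp add: m_assoc)
        show "w \<in> extended P (carrier S)"
          using ws J_def by simp
      qed
      moreover have "(u \<otimes> w [^] r \<otimes> s) \<otimes> w = \<zero> \<oplus> u \<otimes> w [^] Suc r \<otimes> s"
        using ws wc uc by (simp add: m_ac)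
      moreover have "u \<otimes> w [^] Suc r \<otimes> s = \<zero> \<oplus> u \<otimes> w [^] Suc r \<otimes> s"
        using ws wc uc by simp
      ultimately show "u \<otimes> w [^] Suc r \<otimes> s \<in> {b \<oplus> x | b x. b \<in> B \<and> x \<in> extended P T}"
        using sub_closed(1) by (intro CollectI exI[of _ \<zero>] exI[of _ "u \<otimes> w [^] Suc r \<otimes> s"]) simp
    qed
    show "{b \<oplus> x | b x. b \<in> B \<and> x \<in> extended P T} \<subseteq> T"
      using ePT sub by auto
  qed
  obtain gs where gs: "set gs \<subseteq> T" "T \<subseteq> lin_span B gs"
    using FCP_finite[OF int fcp Ts] by blast
  have "\<exists>b\<in>B. \<exists>ts. set ts \<subseteq> T \<and> (\<exists>y\<in>lin_span P ts. x = b \<oplus> y)" if x: "x \<in> T" for x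
  proof -
    obtain b y where "x = b \<oplus> y" "b \<in> B" "y \<in> extended P T"
      using x T1 by blast
    then show ?thesis
      unfolding extended_def by blast
  qed
  then obtain v where v: "v \<in> B" "\<one> \<ominus> v \<in> P" "\<And>x. x \<in> T \<Longrightarrow> v \<otimes> x \<in> B"
    using nakayama[OF P.ideal_axioms T.B_carrier gs] by metis
  have vP: "v \<notin> P"
  proof
    assume "v \<in> P"
    then have "(\<one> \<ominus> v) \<oplus> v \<in> P"
      using v(2) P.add_mem[of "\<one> \<ominus> v" v] by simp
    then show False
      using v(1) P.one_notin by (simp add: minus_eq a_assoc l_neg)
  qed
  \<comment> \<open>The second use of minimality replaces u by v u, which is still outside P because
    v is in 1 + P.\<close>
  have T2: "{b \<oplus> x | b x. b \<in> B \<and> x \<in> (\<lambda>t. v \<otimes> t) ` T} = T"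
  proof (rule min)
    show "{b \<oplus> x | b x. b \<in> B \<and> x \<in> (\<lambda>t. v \<otimes> t) ` T} \<in> F"
    proof (rule FI)
      show "{b \<oplus> x | b x. b \<in> B \<and> x \<in> (\<lambda>t. v \<otimes> t) ` T} \<in> subalgebras B S"
        by (rule scaled_subalgebra[OF v(1) Ts])
      show "v \<otimes> u \<in> B"
        using u v by simp
      show "v \<otimes> u \<notin> P"
        using u v vP P.I_prime[of v u] by auto
      fix w s assume ws: "w \<in> J" "s \<in> carrier S"
      have "v \<otimes> u \<otimes> w [^] r \<otimes> s = \<zero> \<oplus> v \<otimes> (u \<otimes> w [^] r \<otimes> s)"
        using u v ws Jc by (simp add: m_assoc subset_iff)
      moreover have "v \<otimes> (u \<otimes> w [^] r \<otimes> s) \<in> (\<lambda>t. v \<otimes> t) ` T"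
        using ur[OF ws] by blast
      ultimately show "v \<otimes> u \<otimes> w [^] r \<otimes> s \<in> {b \<oplus> x | b x. b \<in> B \<and> x \<in> (\<lambda>t. v \<otimes> t) ` T}"
        using sub_closed(1) by blast
    qed
    show "{b \<oplus> x | b x. b \<in> B \<and> x \<in> (\<lambda>t. v \<otimes> t) ` T} \<subseteq> T"
      using v sub by auto
  qed
  have "x \<in> B" if x: "x \<in> T" for x
  proof -
    obtain b t where "x = b \<oplus> v \<otimes> t" "b \<in> B" "t \<in> T"
      using x T2 by blast
    then show ?thesis
      using v(3) by simp
  qed
  then show thesis
    using that[OF u] ur J_def by blast
qed

end

section \<open>Lifting idempotents\<close>

context cring
begin

lemma minus_chain:
  assumes "a \<in> carrier R" "b \<in> carrier R" "c \<in> carrier R"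
  shows "(a \<ominus> b) \<oplus> (b \<ominus> c) = a \<ominus> c"
  using assms by algebra

lemma one_minus_one_minus: "x \<in> carrier R \<Longrightarrow> \<one> \<ominus> (\<one> \<ominus> x) = x"
  by algebra

lemma one_minus_mult_one_plus:
  assumes "x \<in> carrier R"
  shows "(\<one> \<ominus> x) \<otimes> (\<one> \<oplus> x) = \<one> \<ominus> x \<otimes> x"
  using assms by algebra

text \<open>Modulo K, multiplication by f fixes g, hence so does multiplication by any power of
  f.\<close>

lemma one_minus_pow_mem:
  assumes K: "ideal K R" and gf: "g \<in> carrier R" "f \<in> carrier R" and mem: "g \<otimes> (\<one> \<ominus> f) \<in> K"
  shows "g \<otimes> (\<one> \<ominus> f [^] (m::nat)) \<in> K"
proof (induction m)
  case 0
  have "g \<otimes> (\<one> \<ominus> f [^] (0::nat)) = \<zero>"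
    using gf by (simp add: minus_eq r_neg)
  then show ?case
    using ideal.zero_mem[OF K] by simp
next
  case (Suc m)
  define F where "F = f [^] m"
  have F: "F \<in> carrier R"
    using gf F_def by simp
  have "g \<otimes> (\<one> \<ominus> F) = g \<ominus> g \<otimes> F" "F \<otimes> (g \<otimes> (\<one> \<ominus> f)) = g \<otimes> F \<ominus> g \<otimes> (F \<otimes> f)"
    "g \<otimes> (\<one> \<ominus> F \<otimes> f) = g \<ominus> g \<otimes> (F \<otimes> f)"
    using gf F by (simp_all add: minus_eq r_distr r_minus m_ac)
  then have "g \<otimes> (\<one> \<ominus> f [^] Suc m) = g \<otimes> (\<one> \<ominus> F) \<oplus> F \<otimes> (g \<otimes> (\<one> \<ominus> f))"
    using minus_chain[of g "g \<otimes> F" "g \<otimes> (F \<otimes> f)"] gf F F_def by simp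
  moreover have "F \<otimes> (g \<otimes> (\<one> \<ominus> f)) \<in> K"
    using ideal.I_l_closed[OF K mem F] .
  ultimately show ?case
    using ideal.add_mem[OF K] Suc F_def by simp
qed

text \<open>The lifting step replaces \<open>b\<close> by \<open>1 - (1 - b\<^sup>2)\<^sup>2\<close>, which squares the error \<open>b (1 - b)\<close>.\<close>

lemma lift_idempotent:
  assumes Q: "ideal Q R" "ideal Q' R" and b0: "b0 \<in> Q" "\<one> \<ominus> b0 \<in> Q'"
  shows "\<exists>b\<in>Q. \<one> \<ominus> b \<in> Q' \<and> (\<exists>s\<in>carrier R. b \<otimes> (\<one> \<ominus> b) = (b0 \<otimes> (\<one> \<ominus> b0)) [^] ((2::nat) ^ k) \<otimes> s)"
proof (induction k)
  case 0
  have "b0 \<in> carrier R"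
    using ideal.Icarr[OF Q(1) b0(1)] .
  then show ?case
    using b0 by (intro bexI[of _ b0] conjI bexI[of _ \<one>]) auto
next
  case (Suc k)
  define z where "z = (b0 \<otimes> (\<one> \<ominus> b0)) [^] ((2::nat) ^ k)"
  obtain b s where b: "b \<in> Q" "\<one> \<ominus> b \<in> Q'" "s \<in> carrier R" "b \<otimes> (\<one> \<ominus> b) = z \<otimes> s"
    using Suc z_def by blast
  have b0c: "b0 \<in> carrier R" and bc: "b \<in> carrier R"
    using ideal.Icarr[OF Q(1)] b0(1) b(1) by auto
  then have zc: "z \<in> carrier R"
    using z_def by simp
  \<comment> \<open>Here c = 1 - b^2, so b' = (1 - c)(1 + c) = 1 - c^2. Thus b' is a multiple of b^2
    and 1 - b' = c^2 one of d^2; this squares the error and keeps b' in Q and 1 - b' in Q'.\<close>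
  define d c b' where "d = \<one> \<ominus> b" and "c = d \<otimes> (\<one> \<oplus> b)" and "b' = b \<otimes> b \<otimes> (\<one> \<oplus> c)"
  have dc: "d \<in> carrier R" and cc: "c \<in> carrier R"
    using bc d_def c_def by auto
  have "c = \<one> \<ominus> b \<otimes> b"
    unfolding c_def d_def by (rule one_minus_mult_one_plus[OF bc])
  then have "b \<otimes> b = \<one> \<ominus> c"
    using one_minus_one_minus[of "b \<otimes> b"] bc by simp
  then have "b' = \<one> \<ominus> c \<otimes> c"
    unfolding b'_def using one_minus_mult_one_plus[OF cc] by simp
  then have b'_compl: "\<one> \<ominus> b' = c \<otimes> c"
    using one_minus_one_minus[of "c \<otimes> c"] cc by simp
  have "b' \<otimes> (\<one> \<ominus> b') = (b \<otimes> d) \<otimes> (b \<otimes> d) \<otimes> ((\<one> \<oplus> b) \<otimes> (\<one> \<oplus> b) \<otimes> (\<one> \<oplus> c))"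
  proof -
    define e h where "e = \<one> \<oplus> b" and "h = \<one> \<oplus> c"
    have "e \<in> carrier R" "h \<in> carrier R"
      using bc cc e_def h_def by auto
    then have "b \<otimes> b \<otimes> h \<otimes> ((d \<otimes> e) \<otimes> (d \<otimes> e)) = (b \<otimes> d) \<otimes> (b \<otimes> d) \<otimes> (e \<otimes> e \<otimes> h)"
      using bc dc by (simp add: m_ac)
    then show ?thesis
      unfolding b'_compl unfolding b'_def e_def h_def c_def .
  qed
  also have "\<dots> = (z \<otimes> z) \<otimes> (s \<otimes> s \<otimes> ((\<one> \<oplus> b) \<otimes> (\<one> \<oplus> b) \<otimes> (\<one> \<oplus> c)))"
  proof -
    define e where "e = (\<one> \<oplus> b) \<otimes> (\<one> \<oplus> b) \<otimes> (\<one> \<oplus> c)"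
    have "e \<in> carrier R"
      using bc cc e_def by simp
    then show ?thesis
      unfolding e_def[symmetric] using b(3,4) zc d_def by (simp add: m_ac)
  qed
  also have "z \<otimes> z = (b0 \<otimes> (\<one> \<ominus> b0)) [^] ((2::nat) ^ Suc k)"
    unfolding z_def using b0c by (simp add: nat_pow_mult mult_2)
  finally have "b' \<otimes> (\<one> \<ominus> b') = (b0 \<otimes> (\<one> \<ominus> b0)) [^] ((2::nat) ^ Suc k)
      \<otimes> (s \<otimes> s \<otimes> ((\<one> \<oplus> b) \<otimes> (\<one> \<oplus> b) \<otimes> (\<one> \<oplus> c)))" .
  moreover have "s \<otimes> s \<otimes> ((\<one> \<oplus> b) \<otimes> (\<one> \<oplus> b) \<otimes> (\<one> \<oplus> c)) \<in> carrier R"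
    using b(3) bc cc by simp
  moreover have "b' \<in> Q"
    unfolding b'_def using ideal.I_r_closed[OF Q(1)] b(1) bc cc by simp
  moreover have "\<one> \<ominus> b' \<in> Q'"
    unfolding b'_compl c_def using ideal.I_r_closed[OF Q(2)] b(2) bc dc d_def by simp
  ultimately show ?case
    by blast
qed

end

section \<open>Two primes above the same prime contradict u-closedness\<close>

context subring_extension
begin

text \<open>Modulo P S the trailing coefficients in P vanish and y^a can be factored out, where c is
  the last coefficient outside P. The induction runs from the constant term, which ends the
  list.\<close>

lemma eval_mod_extended:
  assumes P: "primeideal P ring_B" and y: "y \<in> carrier S" and "set l \<subseteq> B"
  shows "set l \<subseteq> P \<and> eval l y \<in> extended P (carrier S) \<or>
    (\<exists>a c h j. c \<in> B - P \<and> h \<in> carrier S \<and> j \<in> extended P (carrier S) \<and>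
       eval l y = y [^] (a::nat) \<otimes> (c \<oplus> y \<otimes> h) \<oplus> j)"
proof -
  interpret P: primeideal P ring_B by fact
  have Pc: "P \<subseteq> carrier S" and P0: "\<zero> \<in> P"
    using P.Icarr P.zero_mem by auto
  define J where "J = extended P (carrier S)"
  have Jc: "j \<in> carrier S" if "j \<in> J" for j
    using extended_carrier[OF Pc subset_refl] that J_def by blast
  have J_add: "i \<oplus> j \<in> J" if "i \<in> J" "j \<in> J" for i j
    using extended_add[OF Pc P0 subset_refl] that unfolding J_def by blast
  have J_mult: "s \<otimes> j \<in> J" if "s \<in> carrier S" "j \<in> J" for s j
    using extended_mult[OF Pc P0 subset_refl subset_refl that(1)] that unfolding J_def by simp
  have PJ: "p \<in> J" if "p \<in> P" for p
    using extended_base[OF Pc subset_refl that one_closed] that Pc unfolding J_def by auto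
  have "set l \<subseteq> P \<and> eval l y \<in> J \<or>
    (\<exists>a c h j. c \<in> B - P \<and> h \<in> carrier S \<and> j \<in> J \<and> eval l y = y [^] (a::nat) \<otimes> (c \<oplus> y \<otimes> h) \<oplus> j)"
    using assms(3)
  proof (induction l rule: rev_induct)
    case Nil
    then show ?case
      using extended_zero J_def by simp
  next
    case (snoc d l)
    have d: "d \<in> B" and l: "set l \<subseteq> carrier S"
      using snoc.prems by auto
    have el: "eval l y \<in> carrier S"
      by (rule eval_in_carrier[OF l y])
    have ev: "eval (l @ [d]) y = eval l y \<otimes> y \<oplus> d"
      using eval_append_aux[OF l _ y] d by auto
    show ?case
    proof (cases "d \<in> P")
      case False
      have "eval (l @ [d]) y = y [^] (0::nat) \<otimes> (d \<oplus> y \<otimes> eval l y) \<oplus> \<zero>"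
        unfolding ev using d el y by (simp add: m_comm a_comm)
      then show ?thesis
        using False d el extended_zero J_def by blast
    next
      case True
      consider "set l \<subseteq> P" "eval l y \<in> J"
        | a c h j where "c \<in> B - P" "h \<in> carrier S" "j \<in> J" "eval l y = y [^] (a::nat) \<otimes> (c \<oplus> y \<otimes> h) \<oplus> j"
        using snoc by auto
      then show ?thesis
      proof cases
        case 1
        have "y \<otimes> eval l y \<oplus> d \<in> J"
          by (intro J_add J_mult PJ y 1 True)
        then have "eval (l @ [d]) y \<in> J"
          unfolding ev using m_comm[OF y el] by simp
        then show ?thesis
          using 1 True by simp
      next
        case 2
        have c: "c \<in> carrier S"
          using 2 by auto
        have "eval (l @ [d]) y = y [^] Suc a \<otimes> (c \<oplus> y \<otimes> h) \<oplus> (y \<otimes> j \<oplus> d)"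
        proof -
          define g where "g = c \<oplus> y \<otimes> h"
          have "g \<in> carrier S"
            using c y 2(2) g_def by simp
          then show ?thesis
            unfolding ev 2(4) g_def[symmetric] using Jc[OF 2(3)] y d
            by (simp add: l_distr r_distr m_ac a_assoc)
        qed
        moreover have "y \<otimes> j \<oplus> d \<in> J"
          by (intro J_add J_mult PJ y 2 True)
        ultimately show ?thesis
          using 2(1,2) by blast
      qed
    qed
  qed
  then show ?thesis
    unfolding J_def .
qed

lemma ideal_extended:
  assumes P: "P \<subseteq> carrier S" "\<zero> \<in> P"
  shows "ideal (extended P (carrier S)) S"
proof (rule ideal_criterion)
  show "extended P (carrier S) \<subseteq> carrier S"
    by (rule extended_carrier[OF P(1) subset_refl])
  show "\<zero> \<in> extended P (carrier S)"
    by (rule extended_zero)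
  show "x \<oplus> y \<in> extended P (carrier S)" if "x \<in> extended P (carrier S)" "y \<in> extended P (carrier S)" for x y
    using that by (rule extended_add[OF P subset_refl])
  show "b \<otimes> x \<in> extended P (carrier S)" if "x \<in> extended P (carrier S)" "b \<in> carrier S" for x b
    using that by (intro extended_mult[OF P subset_refl subset_refl]) auto
qed

text \<open>A monic equation has its leading coefficient outside P, so the previous lemma gives y^a
  (c + y h) in P S. Since c is invertible modulo P, it can be normalized to 1.\<close>

lemma fitting_mod_extended:
  assumes int: "integral" and P: "primeideal P ring_B"
    and max: "\<And>u. u \<in> B \<Longrightarrow> u \<notin> P \<Longrightarrow> \<exists>w\<in>B. \<one> \<ominus> u \<otimes> w \<in> P" and y: "y \<in> carrier S"
  obtains a k where "k \<in> carrier S" "y [^] (a::nat) \<otimes> (\<one> \<ominus> y \<otimes> k) \<in> extended P (carrier S)"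
proof -
  interpret P: primeideal P ring_B by (rule P)
  have Pc: "P \<subseteq> carrier S" and P0: "\<zero> \<in> P"
    using P.Icarr P.zero_mem by auto
  define J where "J = extended P (carrier S)"
  interpret J: ideal J S
    unfolding J_def by (rule ideal_extended[OF Pc P0])
  obtain p where p: "set p \<subseteq> B" "eval (\<one> # p) y = \<zero>"
    using int y unfolding integral_def by blast
  have "\<not> set (\<one> # p) \<subseteq> P"
    using P.one_notin by simp
  then obtain a c h j where *: "c \<in> B" "c \<notin> P" "h \<in> carrier S" "j \<in> J"
      "\<zero> = y [^] (a::nat) \<otimes> (c \<oplus> y \<otimes> h) \<oplus> j"
    using eval_mod_extended[OF P y, of "\<one> # p"] p unfolding J_def by auto
  obtain d where d: "d \<in> B" "\<one> \<ominus> c \<otimes> d \<in> P"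
    using max * by blast
  have cc: "c \<in> carrier S" "d \<in> carrier S" "j \<in> carrier S"
    using * d J.Icarr by auto
  have "y [^] a \<otimes> (c \<oplus> y \<otimes> h) = \<ominus> j"
    using *(3,5) cc y sum_zero_eq_neg[of "y [^] a \<otimes> (c \<oplus> y \<otimes> h)" j] by simp
  then have 1: "d \<otimes> (y [^] a \<otimes> (c \<oplus> y \<otimes> h)) \<in> J"
    using J.I_l_closed[of "\<ominus> j" d] *(4) cc by simp
  have "(\<one> \<ominus> c \<otimes> d) \<otimes> \<one> \<in> J"
    unfolding J_def by (rule extended_base[OF Pc subset_refl d(2) one_closed])
  then have 2: "y [^] a \<otimes> (\<one> \<ominus> c \<otimes> d) \<in> J"
    using J.I_l_closed y cc by simp
  \<comment> \<open>Up to the factor y^a this is 1 + y h d = (1 - c d) + d (c + y h).\<close>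
  have "y [^] a \<otimes> (\<one> \<ominus> y \<otimes> (\<ominus> (h \<otimes> d)))
      = y [^] a \<otimes> (\<one> \<ominus> c \<otimes> d) \<oplus> d \<otimes> (y [^] a \<otimes> (c \<oplus> y \<otimes> h))"
  proof -
    define g q where "g = c \<otimes> d" and "q = y \<otimes> (h \<otimes> d)"
    have gq: "g \<in> carrier S" "q \<in> carrier S"
      using *(3) cc y g_def q_def by auto
    have "d \<otimes> (y [^] a \<otimes> (c \<oplus> y \<otimes> h)) = y [^] a \<otimes> (g \<oplus> q)"
      unfolding g_def q_def using *(3) cc y by (simp add: r_distr m_ac)
    moreover have "(\<one> \<ominus> g) \<oplus> (g \<oplus> q) = \<one> \<oplus> q"
      using gq by (simp add: minus_eq a_assoc r_neg1)
    moreover have "\<one> \<ominus> y \<otimes> (\<ominus> (h \<otimes> d)) = \<one> \<oplus> q"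
      unfolding q_def using *(3) cc y by (simp add: minus_eq r_minus)
    ultimately show ?thesis
      using gq y g_def by (metis r_distr nat_pow_closed minus_closed one_closed a_closed)
  qed
  then have "y [^] a \<otimes> (\<one> \<ominus> y \<otimes> (\<ominus> (h \<otimes> d))) \<in> J"
    using J.add_mem[OF 2 1] by simp
  then show thesis
    using that[of "\<ominus> (h \<otimes> d)" a] *(3) cc J_def by simp
qed

text \<open>Formulated for one y in Q outside Q': two distinct primes admit such an element in one
  of the two orders, which gives injectivity.\<close>

lemma u_closed_not_separated:
  assumes int: "integral" and fcp: "FCP B S" and Q: "primeideal Q S" "primeideal Q' S"
    and eq: "Q \<inter> B = Q' \<inter> B" and y: "y \<in> Q" "y \<notin> Q'" and u_cl: "u_closed B S"
  shows False
proof -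
  interpret Q: primeideal Q S by fact
  interpret Q': primeideal Q' S by fact
  define P where "P = Q \<inter> B"
  have P: "primeideal P ring_B"
    unfolding P_def by (rule primeideal_contraction[OF Q(1)])
  interpret P: primeideal P ring_B by (rule P)
  have PQ: "p \<in> Q" "p \<in> Q'" "p \<in> B" if "p \<in> P" for p
    using that eq P_def by auto
  have notQ': "x \<notin> Q'" if "x \<in> B" "x \<notin> P" for x
    using that eq P_def by auto
  have Pc: "P \<subseteq> carrier S" and P0: "\<zero> \<in> P"
    using PQ P.zero_mem by auto
  have yc: "y \<in> carrier S"
    using y Q.Icarr by simp
  \<comment> \<open>For c in the conductor, c y lies in Q and in B, hence in Q'. As y is outside Q',
    c lies in Q'.\<close>
  have "conductor \<subseteq> P"
  proof
    fix c assume "c \<in> conductor"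
    then have c: "c \<in> B" "c \<otimes> y \<in> B"
      using yc unfolding conductor_def by auto
    moreover have "c \<otimes> y \<in> Q"
      using y c by (intro Q.I_l_closed) auto
    ultimately have "c \<otimes> y \<in> Q'"
      using eq by blast
    then have "c \<in> Q'"
      using Q'.I_prime[of c y] y yc c by auto
    then show "c \<in> P"
      using c eq P_def by blast
  qed
  then have max: "\<exists>w\<in>B. \<one> \<ominus> u \<otimes> w \<in> P" if "u \<in> B" "u \<notin> P" for u
    using maximal_if_conductor_subset[OF int fcp P _ that] by metis
  define J where "J = extended P (carrier S)"
  interpret J: ideal J S
    unfolding J_def by (rule ideal_extended[OF Pc P0])
  have JQ: "j \<in> Q" if "j \<in> J" for j
    using that unfolding J_def by (rule extended_least) (use PQ Q.zero_mem Q.add_mem Q.I_r_closed in auto)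
  have JQ': "j \<in> Q'" if "j \<in> J" for j
    using that unfolding J_def by (rule extended_least) (use PQ Q'.zero_mem Q'.add_mem Q'.I_r_closed in auto)
  have PJ: "p \<in> J" if "p \<in> P" for p
    using extended_base[OF Pc subset_refl that one_closed] that Pc unfolding J_def by auto
  obtain a k where k: "k \<in> carrier S" and yk0: "y [^] (a::nat) \<otimes> (\<one> \<ominus> y \<otimes> k) \<in> extended P (carrier S)"
    by (rule fitting_mod_extended[OF int P max yc])
  have yk: "y [^] a \<otimes> (\<one> \<ominus> y \<otimes> k) \<in> J"
    unfolding J_def by (rule yk0)
  \<comment> \<open>The exponent a + 1 makes e a multiple of y^a, so e (1 - f) lies in J, and then e
    (1 - e) does too. It also puts e into Q when a = 0.\<close>
  define f e where "f = y \<otimes> k" and "e = f [^] Suc a"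
  have fc: "f \<in> carrier S" and ec: "e \<in> carrier S"
    using yc k f_def e_def by auto
  have e_eq: "e = (k [^] a \<otimes> f) \<otimes> y [^] a"
    unfolding e_def f_def using yc k by (simp add: nat_pow_distrib m_ac)
  have "(k [^] a \<otimes> f) \<otimes> (y [^] a \<otimes> (\<one> \<ominus> f)) \<in> J"
    using J.I_l_closed[OF yk, of "k [^] a \<otimes> f"] k fc unfolding f_def[symmetric] by simp
  then have "e \<otimes> (\<one> \<ominus> f) \<in> J"
    unfolding e_eq using k fc yc by (simp add: m_assoc)
  then have e_idem: "e \<otimes> (\<one> \<ominus> e) \<in> J"
    using one_minus_pow_mem[OF J.ideal_axioms ec fc, of "Suc a"] e_def by simp
  have "f \<in> Q"
    unfolding f_def using y k by (intro Q.I_r_closed)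
  then have eQ: "e \<in> Q"
    unfolding e_def using fc by (simp add: Q.I_l_closed)
  have "y [^] a \<notin> Q'"
    using Q'.mem_if_pow_mem[OF yc] y by blast
  moreover have "y [^] a \<otimes> (\<one> \<ominus> f) \<in> Q'"
    using JQ'[OF yk] f_def by simp
  ultimately have "\<one> \<otimes> (\<one> \<ominus> f) \<in> Q'"
    using Q'.I_prime[of "y [^] a" "\<one> \<ominus> f"] yc fc by auto
  then have "\<one> \<otimes> (\<one> \<ominus> e) \<in> Q'"
    unfolding e_def by (rule one_minus_pow_mem[OF Q'.ideal_axioms one_closed fc])
  then have eQ': "\<one> \<ominus> e \<in> Q'"
    using ec by simp
  obtain u0 r where u0: "u0 \<in> B" "u0 \<notin> P"
    and ur: "\<And>w s. w \<in> extended P (carrier S) \<Longrightarrow> s \<in> carrier S \<Longrightarrow> u0 \<otimes> w [^] (r::nat) \<otimes> s \<in> B"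
    using power_in_conductor_locally[OF int fcp P] by metis
  obtain v where v: "v \<in> B" "\<one> \<ominus> u0 \<otimes> v \<in> P"
    using max u0 by blast
  \<comment> \<open>Multiplying u0 by an inverse modulo P gives an element of 1 + P that is still a
    multiple of u0. Replacing e by u e therefore keeps the class modulo J and adds the factor needed
    to reach B.\<close>
  define u where "u = u0 \<otimes> v"
  have uc: "u \<in> carrier S" "u0 \<in> carrier S" "v \<in> carrier S"
    using u0 v u_def by auto
  have uP: "\<one> \<ominus> u \<in> P"
    using v u_def by simp
  define b0 where "b0 = u \<otimes> e"
  have b0c: "b0 \<in> carrier S"
    using uc ec b0_def by simp
  have b0Q: "b0 \<in> Q"
    unfolding b0_def using uc eQ by (intro Q.I_l_closed)
  have split: "\<one> \<ominus> b0 = (\<one> \<ominus> e) \<oplus> e \<otimes> (\<one> \<ominus> u)"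
  proof -
    have "e \<otimes> (\<one> \<ominus> u) = e \<ominus> b0"
      unfolding b0_def using uc ec by (simp add: minus_eq r_distr r_minus m_comm)
    then show ?thesis
      using minus_chain[of \<one> e b0] ec b0c by simp
  qed
  have b0Q': "\<one> \<ominus> b0 \<in> Q'"
    unfolding split using PQ(2)[OF uP] ec by (intro Q'.add_mem eQ' Q'.I_l_closed)
  define w where "w = e \<otimes> (\<one> \<ominus> b0)"
  have wc: "w \<in> carrier S"
    using ec b0c w_def by simp
  have "w = e \<otimes> (\<one> \<ominus> e) \<oplus> e \<otimes> (e \<otimes> (\<one> \<ominus> u))"
    unfolding w_def split using ec uc by (simp add: r_distr)
  then have wJ: "w \<in> J"
    using e_idem PJ[OF uP] ec by (simp add: J.add_mem J.I_l_closed)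
  have z: "b0 \<otimes> (\<one> \<ominus> b0) = u \<otimes> w"
    unfolding w_def using ec b0c uc by (simp add: b0_def m_assoc)
  obtain b s where b: "b \<in> Q" "\<one> \<ominus> b \<in> Q'" "s \<in> carrier S"
      "b \<otimes> (\<one> \<ominus> b) = (u \<otimes> w) [^] ((2::nat) ^ r) \<otimes> s"
    using lift_idempotent[OF Q.ideal_axioms Q'.ideal_axioms b0Q b0Q', of r] z by auto
  have bc: "b \<in> carrier S"
    using b(1) Q.Icarr by simp
  have "r < 2 ^ r"
    by (rule less_exp)
  \<comment> \<open>The exponent 2^r is at least 1 and at least r. So one factor u, hence u0, and
    the power w^r can be split off, and the rest is absorbed into an element x of S.\<close>
  then obtain n where n: "(2::nat) ^ r = Suc n" "(2::nat) ^ r = r + (2 ^ r - r)"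
    by (metis le_add_diff_inverse less_imp_le not0_implies_Suc power_not_zero zero_neq_numeral)
  define x where "x = v \<otimes> u [^] n \<otimes> w [^] ((2::nat) ^ r - r) \<otimes> s"
  have xc: "x \<in> carrier S"
    using uc wc b(3) x_def by simp
  have "(u \<otimes> w) [^] ((2::nat) ^ r) = u [^] Suc n \<otimes> w [^] (r + ((2::nat) ^ r - r))"
    using uc wc n by (metis nat_pow_distrib)
  also have "\<dots> = u [^] n \<otimes> u \<otimes> (w [^] r \<otimes> w [^] ((2::nat) ^ r - r))"
    using wc by (simp add: nat_pow_mult)
  finally have "b \<otimes> (\<one> \<ominus> b) = u0 \<otimes> w [^] r \<otimes> x"
    unfolding b(4) x_def u_def using uc wc b(3) by (simp add: m_ac)
  \<comment> \<open>All of b (1 - b) S lies in B. Taking t = 1 and t = b gives, up to sign, the two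
    conditions of u-closedness.\<close>
  then have in_B: "b \<otimes> (\<one> \<ominus> b) \<otimes> t \<in> B" if "t \<in> carrier S" for t
    using ur[of w "x \<otimes> t"] wJ that uc wc xc unfolding J_def by (simp add: m_assoc)
  have pow: "b [^] (2::nat) = b \<otimes> b" "b [^] (3::nat) = b \<otimes> b \<otimes> b"
    using bc by (simp_all add: numeral_eq_Suc)
  have "b [^] (2::nat) \<ominus> b = \<ominus> (b \<otimes> (\<one> \<ominus> b) \<otimes> \<one>)"
    unfolding pow using bc by algebra
  also have "\<dots> \<in> B"
    by (intro sub_closed(3) in_B one_closed)
  finally have u1: "b [^] (2::nat) \<ominus> b \<in> B" .
  have "b [^] (3::nat) \<ominus> b [^] (2::nat) = \<ominus> (b \<otimes> (\<one> \<ominus> b) \<otimes> b)"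
    unfolding pow using bc by algebra
  also have "\<dots> \<in> B"
    by (intro sub_closed(3) in_B bc)
  finally have u2: "b [^] (3::nat) \<ominus> b [^] (2::nat) \<in> B" .
  have "b \<in> B"
    using u_cl u1 u2 bc unfolding u_closed_def by blast
  then have "b \<in> Q'"
    using b(1) eq by blast
  then have "(\<one> \<ominus> b) \<oplus> b \<in> Q'"
    using b(2) by (intro Q'.add_mem)
  then show False
    using bc Q'.one_notin by (simp add: minus_eq a_assoc l_neg)
qed

lemma inj_Spec_if_u_closed:
  assumes "integral" "FCP B S" "u_closed B S"
  shows "inj_on (\<lambda>Q. Q \<inter> B) (Spec S)"
proof (rule inj_onI)
  fix Q Q' assume "Q \<in> Spec S" "Q' \<in> Spec S" and eq: "Q \<inter> B = Q' \<inter> B"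
  then have Q: "primeideal Q S" "primeideal Q' S"
    by (auto simp: Spec_def)
  show "Q = Q'"
    using u_closed_not_separated[OF assms(1,2) Q eq _ _ assms(3)]
      u_closed_not_separated[OF assms(1,2) Q(2,1) eq[symmetric] _ _ assms(3)] by blast
qed

end

section \<open>Passage to intermediate rings and the conclusion\<close>

lemma FCP_mono:
  assumes "FCP R S" "R \<subseteq> B"
  shows "FCP B S"
proof -
  have sub: "subalgebras B S \<subseteq> subalgebras R S"
    using assms(2) unfolding subalgebras_def by blast
  have "finite C" if C: "subset.chain (subalgebras B S) C" for C
  proof -
    have "subset.chain (subalgebras R S) C"
      using C subset_trans[OF _ sub, of C] by (simp add: subset_chain_def)
    then show ?thesis
      using assms(1) by (simp add: FCP_def)
  qed
  then show ?thesis
    by (simp add: FCP_def)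
qed

text \<open>Integral equations over R are equations over B, and \<open>residue_map_iso_iff\<close>
  turns each residual isomorphism into an existence statement whose witnesses in R also lie in
  B.\<close>

lemma infra_integral_mono:
  assumes R: "infra_integral R S" and B: "B \<in> subalgebras R S"
  shows "infra_integral B S"
proof -
  have S: "cring S" "subcring R S" and sub: "subcring B S" "R \<subseteq> B"
    using assms by (auto simp: infra_integral_def integral_extension_def ring_extension_def subalgebras_def)
  interpret cring S by (rule S)
  have "integral_extension B S"
    using R S sub unfolding infra_integral_def integral_extension_def ring_extension_def by blast
  moreover have "residue_map S Q \<in> ring_iso (residue_field (S\<lparr>carrier := B\<rparr>) (Q \<inter> B)) (residue_field S Q)"
    if Q: "Q \<in> Spec S" for Q
  proof -
    have prime: "primeideal Q S"
      using Q by (simp add: Spec_def)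
    interpret R: prime_of_extension S R Q
      by (intro prime_of_extension.intro subring_extension.intro subring_extension_axioms.intro S prime)
    interpret B: prime_of_extension S B Q
      by (intro prime_of_extension.intro subring_extension.intro subring_extension_axioms.intro S sub prime)
    have "residue_map S Q \<in> ring_iso (residue_field (S\<lparr>carrier := R\<rparr>) (Q \<inter> R)) (residue_field S Q)"
      using R Q by (simp add: infra_integral_def)
    then show ?thesis
      unfolding R.residue_map_iso_iff B.residue_map_iso_iff using sub(2) by blast
  qed
  ultimately show ?thesis
    unfolding infra_integral_def by blast
qed

theorem theorem6p6:
  fixes S :: "('a, 'm) ring_scheme" and R :: "'a set"
  assumes "ring_extension R S"
    and "R \<subset> carrier S"
    and "infra_integral R S"
    and "FCP R S"
  shows "(\<exists>V. is_co_subintegral_closure R S V) \<and>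
         u_closure R S = co_subintegral_closure R S"
proof -
  define U where "U = u_closure R S"
  have U: "U \<in> subalgebras R S" "u_closed U S" and U_least: "U = \<Inter>{B \<in> subalgebras R S. u_closed B S}"
    using u_closure_eq_Inter[OF assms(1)] U_def by auto
  have S: "cring S"
    using assms(1) by (simp add: ring_extension_def)
  have integral: "subring_extension.integral S B" if B: "subcring B S" "integral_extension B S" for B
  proof -
    interpret subring_extension S B
      by (intro subring_extension.intro subring_extension_axioms.intro S B)
    show ?thesis
      using B(2) unfolding integral_def integral_extension_def by blast
  qed
  have infra: "infra_integral U S"
    by (rule infra_integral_mono[OF assms(3) U(1)])
  moreover have "inj_on (\<lambda>Q. Q \<inter> U) (Spec S)"
  proof -
    have sub: "subcring U S" "R \<subseteq> U"
      using U(1) by (auto simp: subalgebras_def)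
    interpret subring_extension S U
      by (intro subring_extension.intro subring_extension_axioms.intro S sub)
    show ?thesis
      using inj_Spec_if_u_closed integral sub infra FCP_mono[OF assms(4)] U(2)
      unfolding infra_integral_def by blast
  qed
  ultimately have "subintegral U S"
    by (simp add: subintegral_def)
  \<comment> \<open>Injectivity on spectra makes W u-closed in S, and U is the intersection of all
    u-closed subalgebras.\<close>
  moreover have "U \<subseteq> W" if W: "W \<in> subalgebras R S" "subintegral W S" for W
  proof -
    have sub: "subcring W S"
      using W(1) by (auto simp: subalgebras_def)
    interpret subring_extension S W
      by (intro subring_extension.intro subring_extension_axioms.intro S sub)
    have "u_closed W S"
      using u_closed_if_inj_Spec integral[OF sub] W(2)
      unfolding subintegral_def infra_integral_def by blast
    then show ?thesis
      using U_least W(1) by blast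
  qed
  ultimately have closure: "is_co_subintegral_closure R S U"
    using U(1) unfolding is_co_subintegral_closure_def by blast
  \<comment> \<open>Two co-subintegral closures contain each other, so the description by
    \<open>THE\<close> denotes U.\<close>
  then have "co_subintegral_closure R S = U"
    unfolding co_subintegral_closure_def
    by (rule the_equality) (use closure in \<open>auto simp: is_co_subintegral_closure_def\<close>)
  then show ?thesis
    using closure U_def by blast
qed

end
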